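(* Let $n\ge 2$. (a) If two $n$-linear forms $F\colon U\times\dots\times U\to\mathbb{C}$ and $G\colon V\times\dots\times V\to\mathbb{C}$ on finite-dimensional complex vector spaces $U$ and $V$ are symmetrically equivalent, then they are congruent. (b) Let $F\colon U\times\dots\times U\to\mathbb{R}$ and $G\colon V\times\dots\times V\to\mathbb{R}$ be symmetrically equivalent $n$-linear forms on finite-dimensional real vector spaces $U$ and $V$, and let \[ F=F_1\oplus\dots\oplus F_s\oplus 0,\qquad G=G_1\oplus\dots\oplus G_r\oplus 0 \] be decompositions of them in which all summands $F_i$ and $G_j$ are nonzero and indecomposable. Then $s=r$ and, after a suitable reindexing, each $F_i$ is congruent to $G_i$ or to $-G_i$.
   Context: An $n$-linear form ($n\ge2$) on a finite-dimensional vector space $U$ over a field $\mathbb{K}$ is a map $F\colon U\times\dots\times U\to\mathbb{K}$ ($n$ factors) that is linear in each argument. Two $n$-linear forms $F$ on $U$ and $G$ on $V$ over $\mathbb{K}$ are symmetrically equivalent if there exist linear bijections $\varphi_1,\dots,\varphi_n\colon U\to V$ such that $F(u_1,\dots,u_n)=G(\varphi_{i_1}u_1,\dots,\varphi_{i_n}u_n)$ for all $u_1,\dots,u_n\in U$ and each reordering (permutation) $i_1,\dots,i_n$ of $1,\dots,n$ (the same $\varphi_1,\dots,\varphi_n$ for all reorderings). They are congruent if there is a linear bijection $\varphi\colon U\to V$ with $F(u_1,\dots,u_n)=G(\varphi u_1,\dots,\varphi u_n)$ for all $u_1,\dots,u_n\in U$. Direct sums are internal: $F=F_1\oplus\dots\oplus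 F_k$ means that there is a decomposition $U=U_1\oplus\dots\oplus U_k$ (the corresponding decomposition) such that $F(x_1,\dots,x_n)=0$ whenever $x_i\in U_p$ and $x_j\in U_q$ for some $i,j$ and some $p\ne q$, and $F_p=F|U_p$ is the restriction of $F$ to $U_p$ for each $p$. A summand written $0$ is the zero form on its (possibly zero) subspace. A form $F$ on $U$ is indecomposable if for each decomposition $F=F_1\oplus F_2$ with corresponding decomposition $U=U_1\oplus U_2$ we have $U_1=0$ or $U_2=0$. *)

theory Defs
  imports Complex_Main "HOL-Library.FuncSet" "HOL-Combinatorics.Permutations"
begin

text \<open>
  A finite-dimensional vector space is a finitely generated subspace \<open>U\<close> of an ambient space with
  scalar multiplication \<open>sc\<close>; \<open>U = UNIV\<close> is allowed. Carriers are sets because the summands of a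
  direct sum are spaces in their own right.
\<close>

definition fin_dim_space :: "('k::field \<Rightarrow> 'a::ab_group_add \<Rightarrow> 'a) \<Rightarrow> 'a set \<Rightarrow> bool" where
  "fin_dim_space sc U \<longleftrightarrow>
     vector_space sc \<and> module.subspace sc U \<and> (\<exists>B. finite B \<and> module.span sc B = U)"

definition linear_on ::
  "('k::field \<Rightarrow> 'a::ab_group_add \<Rightarrow> 'a) \<Rightarrow> 'a set \<Rightarrow> ('k \<Rightarrow> 'b::ab_group_add \<Rightarrow> 'b) \<Rightarrow> ('a \<Rightarrow> 'b) \<Rightarrow> bool"
where
  "linear_on sc U sc' f \<longleftrightarrow>
     (\<forall>x\<in>U. \<forall>y\<in>U. f (x + y) = f x + f y) \<and> (\<forall>c. \<forall>x\<in>U. f (sc c x) = sc' c (f x))"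

definition linear_bij ::
  "('k::field \<Rightarrow> 'a::ab_group_add \<Rightarrow> 'a) \<Rightarrow> 'a set \<Rightarrow>
   ('k \<Rightarrow> 'b::ab_group_add \<Rightarrow> 'b) \<Rightarrow> 'b set \<Rightarrow> ('a \<Rightarrow> 'b) \<Rightarrow> bool"
where
  "linear_bij scU U scV V \<phi> \<longleftrightarrow> linear_on scU U scV \<phi> \<and> bij_betw \<phi> U V"

text \<open>
  An \<open>n\<close>-tuple is an extensional function on \<open>{..<n}\<close>. A form on \<open>U\<close> is only ever evaluated at
  elements of \<open>tuples n U\<close>; in particular, its restriction to a subspace \<open>W\<close> of \<open>U\<close> is the same
  function regarded as a form on \<open>W\<close>.
\<close>

abbreviation tuples :: "nat \<Rightarrow> 'a set \<Rightarrow> (nat \<Rightarrow> 'a) set" where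
  "tuples n U \<equiv> {..<n} \<rightarrow>\<^sub>E U"

definition multilinear_form ::
  "nat \<Rightarrow> ('k::field \<Rightarrow> 'a::ab_group_add \<Rightarrow> 'a) \<Rightarrow> 'a set \<Rightarrow> ((nat \<Rightarrow> 'a) \<Rightarrow> 'k) \<Rightarrow> bool"
where
  "multilinear_form n sc U F \<longleftrightarrow>
     (\<forall>i<n. \<forall>u\<in>tuples n U. linear_on sc U (*) (\<lambda>x. F (u(i := x))))"

definition symmetrically_equivalent ::
  "nat \<Rightarrow> ('k::field \<Rightarrow> 'a::ab_group_add \<Rightarrow> 'a) \<Rightarrow> 'a set \<Rightarrow> ((nat \<Rightarrow> 'a) \<Rightarrow> 'k) \<Rightarrow>
   ('k \<Rightarrow> 'b::ab_group_add \<Rightarrow> 'b) \<Rightarrow> 'b set \<Rightarrow> ((nat \<Rightarrow> 'b) \<Rightarrow> 'k) \<Rightarrow> bool"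
where
  "symmetrically_equivalent n scU U F scV V G \<longleftrightarrow>
     (\<exists>\<phi> :: nat \<Rightarrow> 'a \<Rightarrow> 'b. (\<forall>i<n. linear_bij scU U scV V (\<phi> i)) \<and>
        (\<forall>\<sigma>. \<sigma> permutes {..<n} \<longrightarrow>
           (\<forall>u\<in>tuples n U. F u = G (\<lambda>k\<in>{..<n}. \<phi> (\<sigma> k) (u k)))))"

definition congruent_forms ::
  "nat \<Rightarrow> ('k::field \<Rightarrow> 'a::ab_group_add \<Rightarrow> 'a) \<Rightarrow> 'a set \<Rightarrow> ((nat \<Rightarrow> 'a) \<Rightarrow> 'k) \<Rightarrow>
   ('k \<Rightarrow> 'b::ab_group_add \<Rightarrow> 'b) \<Rightarrow> 'b set \<Rightarrow> ((nat \<Rightarrow> 'b) \<Rightarrow> 'k) \<Rightarrow> bool"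
where
  "congruent_forms n scU U F scV V G \<longleftrightarrow>
     (\<exists>\<phi>. linear_bij scU U scV V \<phi> \<and>
        (\<forall>u\<in>tuples n U. F u = G (\<lambda>k\<in>{..<n}. \<phi> (u k))))"

text \<open>
  \<open>W 0, \<dots>, W (k - 1)\<close> are subspaces with internal direct sum \<open>U\<close>: every element of \<open>U\<close> is uniquely a
  sum of components \<open>w p \<in> W p\<close>, and every such sum lies in \<open>U\<close>.
\<close>

definition subspace_direct_sum ::
  "('k::field \<Rightarrow> 'a::ab_group_add \<Rightarrow> 'a) \<Rightarrow> 'a set \<Rightarrow> nat \<Rightarrow> (nat \<Rightarrow> 'a set) \<Rightarrow> bool"
where
  "subspace_direct_sum sc U k W \<longleftrightarrow>
     (\<forall>p<k. module.subspace sc (W p)) \<and>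
     bij_betw (\<lambda>w. \<Sum>p<k. w p) (Pi\<^sub>E {..<k} W) U"

text \<open>The summands of the form are the restrictions of \<open>F\<close> to the \<open>W p\<close>.\<close>

definition form_direct_sum ::
  "nat \<Rightarrow> ('k::field \<Rightarrow> 'a::ab_group_add \<Rightarrow> 'a) \<Rightarrow> 'a set \<Rightarrow> ((nat \<Rightarrow> 'a) \<Rightarrow> 'k) \<Rightarrow>
   nat \<Rightarrow> (nat \<Rightarrow> 'a set) \<Rightarrow> bool"
where
  "form_direct_sum n sc U F k W \<longleftrightarrow>
     subspace_direct_sum sc U k W \<and>
     (\<forall>x\<in>tuples n U. \<forall>i<n. \<forall>j<n. \<forall>p<k. \<forall>q<k.
        x i \<in> W p \<longrightarrow> x j \<in> W q \<longrightarrow> p \<noteq> q \<longrightarrow> F x = 0)"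

definition indecomposable_form ::
  "nat \<Rightarrow> ('k::field \<Rightarrow> 'a::ab_group_add \<Rightarrow> 'a) \<Rightarrow> 'a set \<Rightarrow> ((nat \<Rightarrow> 'a) \<Rightarrow> 'k) \<Rightarrow> bool"
where
  "indecomposable_form n sc U F \<longleftrightarrow>
     (\<forall>W. form_direct_sum n sc U F 2 W \<longrightarrow> W 0 = {0} \<or> W 1 = {0})"

definition zero_form :: "nat \<Rightarrow> 'a set \<Rightarrow> ((nat \<Rightarrow> 'a) \<Rightarrow> 'k::field) \<Rightarrow> bool" where
  "zero_form n U F \<longleftrightarrow> (\<forall>u\<in>tuples n U. F u = 0)"

text \<open>
  \<open>F = F\<^sub>0 \<oplus> \<dots> \<oplus> F\<^sub>s\<^sub>-\<^sub>1 \<oplus> 0\<close> with nonzero indecomposable \<open>F\<^sub>i\<close> on \<open>W i\<close>; the last subspace \<open>W s\<close>, possibly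
  zero, carries the zero summand.
\<close>

definition indecomposable_decomposition ::
  "nat \<Rightarrow> ('k::field \<Rightarrow> 'a::ab_group_add \<Rightarrow> 'a) \<Rightarrow> 'a set \<Rightarrow> ((nat \<Rightarrow> 'a) \<Rightarrow> 'k) \<Rightarrow>
   nat \<Rightarrow> (nat \<Rightarrow> 'a set) \<Rightarrow> bool"
where
  "indecomposable_decomposition n sc U F s W \<longleftrightarrow>
     form_direct_sum n sc U F (Suc s) W \<and>
     (\<forall>i<s. \<not> zero_form n (W i) F \<and> indecomposable_form n sc (W i) F) \<and>
     zero_form n (W s) F"

end

theory Submission
  imports Defs "HOL-Computational_Algebra.Fundamental_Theorem_Algebra"
begin

text \<open>
  Call an operator \<open>T\<close> on \<open>U\<close> self-adjoint for a form \<open>F\<close> if the value of \<open>F\<close> does not depend on the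
  argument to which \<open>T\<close> is applied. Polynomials in a self-adjoint operator are self-adjoint, and
  \<open>F (R\<^sup>n u\<^sub>1, u\<^sub>2, \<dots>, u\<^sub>n) = F (R u\<^sub>1, \<dots>, R u\<^sub>n)\<close> if \<open>R\<close> is self-adjoint: the \<open>n\<close> factors \<open>R\<close> can be moved
  one by one to the \<open>n\<close> arguments.

  Let \<open>\<phi>\<^sub>0, \<dots>, \<phi>\<^sub>n\<^sub>-\<^sub>1\<close> be a symmetric equivalence from \<open>F\<close> to \<open>G\<close>. Exchanging two of the indices shows
  that each \<open>\<psi>\<^sub>k = \<phi>\<^sub>k \<phi>\<^sub>0\<^sup>-\<^sup>1\<close> is self-adjoint for \<open>G\<close>. All the \<open>\<psi>\<^sub>k\<close> can therefore be collected in one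
  argument, and \<open>F u = G (T v\<^sub>0, v\<^sub>1, \<dots>)\<close> with \<open>v = \<phi>\<^sub>0 u\<close> and a single bijective self-adjoint \<open>T\<close>
  (\<open>symmetrically_equivalent_imp_twist\<close>). So \<open>F\<close> is \<open>G\<close> twisted by \<open>T\<close>.

  Over the complex numbers, \<open>T = R\<^sup>n\<close> for a polynomial \<open>R\<close> in \<open>T\<close>. Distributing the factors shows that
  \<open>R \<phi>\<^sub>0\<close> is a congruence, which is part (a).

  Over the reals, negative eigenvalues may obstruct the root, but \<open>R\<^sup>n = S T\<close> for polynomials \<open>R\<close>, \<open>S\<close> in \<open>T\<close>
  with \<open>S\<^sup>2 = 1\<close>. The eigenspaces of \<open>S\<close> decompose \<open>G\<close> as \<open>G\<^sub>+ \<oplus> G\<^sub>-\<close>, and \<open>F\<close> is congruent to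
  \<open>G\<^sub>+ \<oplus> (- G\<^sub>-)\<close>. Hence \<open>F\<close> and \<open>G\<close> possess decompositions into indecomposable summands that match up
  to sign (\<open>twisted_common_decomposition\<close>), and part (b) follows once decompositions of one form are
  known to be unique up to congruence and sign (\<open>form_decomp_unique\<close>).

  Uniqueness is an exchange argument in the manner of Krull and Schmidt. A self-adjoint operator of an
  indecomposable form is injective or nilpotent. If \<open>e\<close> is the projection to an indecomposable summand
  \<open>A\<close> and \<open>h\<^sub>1, h\<^sub>2, \<dots>\<close> are the projections of a second decomposition, then the operators \<open>e h\<^sub>j\<close> on
  \<open>A\<close> are self-adjoint with sum \<open>1\<close>, and one of them, for \<open>h = h\<^sub>j\<close>, is bijective; the projection to
  the zero summand is ruled out, as \<open>F\<close> does not vanish on \<open>A\<close>. From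
  \<open>F (h u\<^sub>1, \<dots>, h u\<^sub>n) = F (e h u\<^sub>1, u\<^sub>2, \<dots>, u\<^sub>n)\<close> on \<open>A\<close> and a root of \<open>\<plusminus> e h\<close> it follows that \<open>A\<close> is
  congruent, up to sign, to the image of \<open>h\<close>. The same identity for \<open>1 - e\<close> and \<open>1 - h\<close> says that the
  complementary forms are twists of each other. They need not be congruent, but by the previous
  paragraph they have decompositions that match up to sign, and this is enough for an induction on the
  number of summands.
\<close>

section \<open>Roots of the indeterminate modulo a polynomial\<close>

lemma power_add_mod_square:
  fixes x y :: "'r::comm_ring_1"
  shows "\<exists>t. (x + y) ^ n = x ^ n + of_nat n * x ^ (n - 1) * y + y ^ 2 * t"
proof (induction n)
  case 0
  show ?case by (intro exI[of _ 0]) simp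
next
  case (Suc n)
  then obtain t where t: "(x + y) ^ n = x ^ n + of_nat n * x ^ (n - 1) * y + y ^ 2 * t"
    by blast
  have "x * (of_nat n * x ^ (n - 1)) = of_nat n * x ^ n"
    by (cases n) (simp_all add: algebra_simps)
  then have "(x + y) ^ Suc n = x ^ Suc n + of_nat (Suc n) * x ^ (Suc n - 1) * y
      + y ^ 2 * (x * t + of_nat n * x ^ (n - 1) + y * t)"
    unfolding power_Suc t by (simp add: algebra_simps power2_eq_square)
  then show ?case by blast
qed

text \<open>
  Newton iteration, one root at a time. The homomorphism \<open>ev\<close> is evaluation at a root of \<open>Q\<close>, and a
  solution of \<open>p\<^sup>n = g\<close> modulo \<open>m\<close> is corrected by a multiple of \<open>m\<close>. If the root is new, its correction
  can be chosen freely to hit the prescribed value \<open>w\<close>; if it is already a root of \<open>m\<close>, the correction is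
  found from the linearised equation, which is solvable as \<open>ev p \<noteq> 0\<close>.
\<close>

lemma root_lift_step:
  fixes ev :: "'r::comm_ring_1 \<Rightarrow> 'f::field_char_0"
  assumes ev_add: "\<And>f h. ev (f + h) = ev f + ev h"
    and ev_mult: "\<And>f h. ev (f * h) = ev f * ev h"
    and ev_one: "ev 1 = 1"
    and ev_surj: "surj ev"
    and ker: "\<And>f. ev f = 0 \<Longrightarrow> Q dvd f"
    and m: "m dvd p ^ n - g" and n: "n > 0"
    and w: "w ^ n = ev g" "ev g \<noteq> 0"
  obtains p' where "m dvd p' - p" "Q * m dvd p' ^ n - g" "ev m \<noteq> 0 \<Longrightarrow> ev p' = w"
proof -
  have ev0: "ev 0 = 0" using ev_add[of 0 0] by simp
  have ev_minus: "ev (f - h) = ev f - ev h" for f h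
    using ev_add[of "f - h" h] by simp
  have ev_pow: "ev (f ^ k) = ev f ^ k" for f k
    by (induction k) (simp_all add: ev_one ev_mult)
  have ev_nat: "ev (of_nat k) = of_nat k" for k
    by (induction k) (simp_all add: ev0 ev_one ev_add)
  from m obtain h where h: "p ^ n - g = m * h" by blast
  show ?thesis
  proof (cases "ev m = 0")
    case False
    obtain c where c: "ev c = (w - ev p) / ev m" using ev_surj by (metis surjD)
    have val: "ev (p + m * c) = w" using c False by (simp add: ev_add ev_mult)
    have "\<exists>k. (p + m * c) ^ n - g = m * k"
    proof -
      obtain t where "(p + m * c) ^ n
          = p ^ n + of_nat n * p ^ (n - 1) * (m * c) + (m * c) ^ 2 * t"
        using power_add_mod_square by blast
      then have "(p + m * c) ^ n - g
          = m * (h + of_nat n * p ^ (n - 1) * c + m * c ^ 2 * t)"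
        using h by (simp add: algebra_simps power2_eq_square)
      then show ?thesis by blast
    qed
    then obtain k where k: "(p + m * c) ^ n - g = m * k" by blast
    have "ev m * ev k = 0"
      unfolding ev_mult[symmetric] k[symmetric] ev_minus ev_pow val by (simp add: w)
    then have "Q dvd k" using False ker by simp
    then have "Q * m dvd (p + m * c) ^ n - g"
      unfolding k by (simp add: mult.commute[of Q] mult_dvd_mono)
    then show ?thesis using that[of "p + m * c"] val by simp
  next
    case True
    have "ev p ^ n = ev g"
      using arg_cong[OF h, of ev] True by (simp add: ev_minus ev_mult ev_pow)
    then have p0: "ev p \<noteq> 0" using w n by (auto simp: power_0_left)
    obtain c where c: "ev c = - ev h / (of_nat n * ev p ^ (n - 1))"
      using ev_surj by (metis surjD)
    obtain t where "(p + m * c) ^ n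
        = p ^ n + of_nat n * p ^ (n - 1) * (m * c) + (m * c) ^ 2 * t"
      using power_add_mod_square by blast
    then have k: "(p + m * c) ^ n - g
        = m * (h + of_nat n * p ^ (n - 1) * c + m * (c ^ 2 * t))"
      using h by (simp add: algebra_simps power2_eq_square)
    have "ev (h + of_nat n * p ^ (n - 1) * c + m * (c ^ 2 * t)) = 0"
      using p0 n by (simp add: ev_add ev_mult ev_nat ev_pow c True)
    then have "Q * m dvd (p + m * c) ^ n - g"
      unfolding k using ker by (simp add: mult.commute[of Q] mult_dvd_mono)
    then show ?thesis using that[of "p + m * c"] True by simp
  qed
qed

lemma complex_root_exists:
  assumes "n > 0"
  obtains w :: complex where "w ^ n = z"
proof (cases "z = 0")
  case True
  then show ?thesis using that[of 0] assms by simp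
next
  case False
  then have "card {w. w ^ n = z} = n" using card_nth_roots assms by blast
  then have "{w. w ^ n = z} \<noteq> {}" using assms by force
  then show ?thesis using that by blast
qed

text \<open>
  Evaluated at an operator annihilated by \<open>m\<close>, this is an \<open>n\<close>-th root of that operator. The nonzero
  constant term says that \<open>0\<close> is not a root of \<open>m\<close>; it keeps the Newton step regular.
\<close>

lemma complex_poly_root_of_X:
  fixes m :: "complex poly"
  assumes "poly m 0 \<noteq> 0" "n > 0"
  shows "\<exists>p. m dvd p ^ n - [:0, 1:]"
  using assms(1)
proof (induction "degree m" arbitrary: m rule: less_induct)
  case less
  show ?case
  proof (cases "degree m = 0")
    case True
    moreover have "m \<noteq> 0" using less.prems by auto
    ultimately have "m dvd 1" using is_unit_iff_degree by blast
    then show ?thesis using dvd_trans one_dvd by blast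
  next
    case False
    then obtain a where a: "poly m a = 0"
      using fundamental_theorem_of_algebra[of m] constant_degree[of m] by auto
    then obtain m' where m': "m = [:- a, 1:] * m'" by (auto simp: poly_eq_0_iff_dvd)
    have "m \<noteq> 0" using less.prems by auto
    with m' less.prems have nz: "m \<noteq> 0" "a \<noteq> 0" "poly m' 0 \<noteq> 0" by auto
    then have "degree m' < degree m" unfolding m' by (subst degree_mult_eq) auto
    then obtain p where p: "m' dvd p ^ n - [:0, 1:]" using less.hyps nz by blast
    obtain w where w: "w ^ n = a" using complex_root_exists \<open>n > 0\<close> by blast
    have surj: "surj (\<lambda>f. poly f a)"
      by (rule surjI[of _ "\<lambda>z. [:z:]"]) simp
    show ?thesis
      by (rule root_lift_step[OF _ _ _ surj _ p \<open>n > 0\<close>, of "[:- a, 1:]" w])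
        (use w nz in \<open>auto simp: poly_eq_0_iff_dvd m'\<close>)
  qed
qed

text \<open>
  The sign \<open>q\<close> is lifted first, with value \<open>d\<close> at a new root, and then \<open>p\<close> is lifted with the corrected
  right-hand side. The sign has to be chosen such that \<open>d\<close> times the root has an \<open>n\<close>-th root in the field
  of values.
\<close>

lemma real_poly_lift_sign_root_step:
  fixes ev :: "real poly \<Rightarrow> 'f::field_char_0"
  assumes ev_add: "\<And>f h. ev (f + h) = ev f + ev h"
    and ev_mult: "\<And>f h. ev (f * h) = ev f * ev h"
    and ev_one: "ev 1 = 1"
    and ev_surj: "surj ev"
    and ker: "\<And>f. ev f = 0 \<Longrightarrow> Q dvd f"
    and q: "m dvd q ^ 2 - 1" and p: "m dvd p ^ n - q * [:0, 1:]" and n: "n > 0"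
    and nz: "ev [:0, 1:] \<noteq> 0"
    and w: "d \<in> {1, - 1}" "w ^ n = d * ev [:0, 1:]"
  shows "\<exists>p q. Q * m dvd q ^ 2 - 1 \<and> Q * m dvd p ^ n - q * [:0, 1:]"
proof -
  have d: "d ^ 2 = ev 1" using w(1) ev_one by auto
  obtain q' where q': "m dvd q' - q" "Q * m dvd q' ^ 2 - 1" "ev m \<noteq> 0 \<Longrightarrow> ev q' = d"
    by (rule root_lift_step[OF ev_add ev_mult ev_one ev_surj ker q _ d]) (use ev_one in auto)
  have "p ^ n - q' * [:0, 1:] = (p ^ n - q * [:0, 1:]) - (q' - q) * [:0, 1:]"
    by (simp add: algebra_simps)
  then have p': "m dvd p ^ n - q' * [:0, 1:]"
    using dvd_diff[OF p dvd_mult2[OF q'(1)]] by metis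
  have ev_minus: "ev (f - h) = ev f - ev h" for f h
    using ev_add[of "f - h" h] by simp
  have "ev q' ^ 2 = 1 \<or> ev m \<noteq> 0"
  proof -
    obtain k where k: "q' ^ 2 - 1 = m * k"
      using dvd_mult_right[OF q'(2)] by blast
    show ?thesis using arg_cong[OF k, of ev]
      by (auto simp: power2_eq_square ev_minus ev_mult ev_one)
  qed
  then have q0: "ev q' \<noteq> 0" using w(1) q'(3) by auto
  define v where "v = (if ev m = 0 then ev p else w)"
  have ev_pow: "ev (f ^ k) = ev f ^ k" for f k
    by (induction k) (simp_all add: ev_one ev_mult)
  have v: "v ^ n = ev (q' * [:0, 1:])"
  proof (cases "ev m = 0")
    case True
    obtain k where k: "p ^ n - q' * [:0, 1:] = m * k" using p' by blast
    show ?thesis using arg_cong[OF k, of ev] True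
      by (simp add: ev_minus ev_mult ev_pow v_def)
  next
    case False
    then show ?thesis using w q'(3) unfolding ev_mult by (simp add: v_def)
  qed
  obtain p'' where "Q * m dvd p'' ^ n - q' * [:0, 1:]"
    by (rule root_lift_step[OF ev_add ev_mult ev_one ev_surj ker p' n v])
      (use nz q0 in \<open>auto simp del: mult_pCons_right simp: ev_mult\<close>)
  with q'(2) show ?thesis by blast
qed

lemma map_poly_of_real_add:
  "map_poly complex_of_real (f + h) = map_poly of_real f + map_poly of_real h"
  by (intro poly_eqI) (simp add: coeff_map_poly)

lemma map_poly_of_real_mult:
  "map_poly complex_of_real (f * h) = map_poly of_real f * map_poly of_real h"
  by (intro poly_eqI) (simp add: coeff_map_poly coeff_mult)

lemma poly_map_poly_of_real:
  "poly (map_poly complex_of_real f) (of_real x) = of_real (poly f x)"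
  by (induction f) (simp_all add: map_poly_pCons)

text \<open>
  The quadratic polynomial is \<open>(X - a) (X - cnj a)\<close>, the minimal polynomial of \<open>a\<close> over the reals.
\<close>

lemma quadratic_dvd_of_nonreal_root:
  fixes f :: "real poly" and a :: complex
  assumes a: "Im a \<noteq> 0" and f: "poly (map_poly of_real f) a = 0"
  shows "[:(cmod a)\<^sup>2, - 2 * Re a, 1:] dvd f"
proof -
  define Q where "Q = [:(cmod a)\<^sup>2, - 2 * Re a, 1:]"
  have Qa: "poly (map_poly of_real Q) a = 0"
    unfolding Q_def
    by (simp add: map_poly_pCons complex_eq_iff cmod_def power2_eq_square algebra_simps)
  define r where "r = f mod Q"
  have "f = Q * (f div Q) + r" by (simp add: r_def)
  then have "map_poly complex_of_real f
      = map_poly of_real Q * map_poly of_real (f div Q) + map_poly of_real r"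
    by (metis map_poly_of_real_add map_poly_of_real_mult)
  then have ra: "poly (map_poly complex_of_real r) a = 0" using f Qa by simp
  have "degree r < 2"
    using degree_mod_less[of Q f] by (auto simp: Q_def r_def)
  then have "r = [:coeff r 0, coeff r 1:]"
    by (intro poly_eqI) (simp add: coeff_pCons coeff_eq_0 split: nat.split)
  then obtain b c where bc: "r = [:b, c:]" by blast
  then have "complex_of_real b + a * complex_of_real c = 0"
    using ra by (simp add: map_poly_pCons)
  then have "c = 0" "b = 0" using a by (auto simp: complex_eq_iff)
  then show ?thesis using bc by (simp add: Q_def r_def mod_eq_0_iff_dvd)
qed

text \<open>
  A real polynomial is built up from its complex roots. At a real root the sign is that of the root; at
  a pair of conjugate nonreal roots the field of values is \<open>\<complex>\<close>, and the sign \<open>1\<close> works.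
\<close>

lemma real_poly_signed_root_of_X:
  fixes m :: "real poly"
  assumes "poly m 0 \<noteq> 0" "n > 0"
  shows "\<exists>p q. m dvd q ^ 2 - 1 \<and> m dvd p ^ n - q * [:0, 1:]"
  using assms(1)
proof (induction "degree m" arbitrary: m rule: less_induct)
  case less
  show ?case
  proof (cases "degree m = 0")
    case True
    moreover have "m \<noteq> 0" using less.prems by auto
    ultimately have "m dvd 1" using is_unit_iff_degree by blast
    then show ?thesis using dvd_trans one_dvd by blast
  next
    case False
    then have "degree (map_poly complex_of_real m) \<noteq> 0"
      by (subst map_poly_degree_eq) auto
    then obtain a where a: "poly (map_poly complex_of_real m) a = 0"
      using fundamental_theorem_of_algebra constant_degree by metis
    show ?thesis
    proof (cases "Im a = 0")
      case True
      then obtain x where x: "a = of_real x" by (metis complex_is_Real_iff Reals_cases)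
      then have "poly m x = 0" using a
        by (simp add: x poly_map_poly_of_real)
      then obtain m' where m': "m = [:- x, 1:] * m'" by (auto simp: poly_eq_0_iff_dvd)
      have "m \<noteq> 0" using less.prems by auto
    with m' less.prems have nz: "m \<noteq> 0" "x \<noteq> 0" "poly m' 0 \<noteq> 0" by auto
      then have "degree m' < degree m" unfolding m' by (subst degree_mult_eq) auto
      then obtain p q where pq: "m' dvd q ^ 2 - 1" "m' dvd p ^ n - q * [:0, 1:]"
        using less.hyps nz by blast
      have surj: "surj (\<lambda>f. poly f x)"
        by (rule surjI[of _ "\<lambda>z. [:z:]"]) simp
      have "root n \<bar>x\<bar> ^ n = \<bar>x\<bar>" using \<open>n > 0\<close> by simp
      then have w: "root n \<bar>x\<bar> ^ n = sgn x * poly [:0, 1:] x"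
        by (simp add: sgn_if)
      show ?thesis unfolding m'
        by (rule real_poly_lift_sign_root_step[OF _ _ _ surj _ pq \<open>n > 0\<close> _ _ w])
          (use nz in \<open>auto simp: poly_eq_0_iff_dvd sgn_if\<close>)
    next
      case False
      define Q where "Q = [:(cmod a)\<^sup>2, - 2 * Re a, 1:]"
      have "Q dvd m" unfolding Q_def using quadratic_dvd_of_nonreal_root False a by blast
      then obtain m' where m': "m = Q * m'" by blast
      with less.prems have nz: "m \<noteq> 0" "poly m' 0 \<noteq> 0" by auto
      have "Q \<noteq> 0" "degree Q = 2" by (auto simp: Q_def)
      then have "degree m' < degree m" using nz unfolding m' by (subst degree_mult_eq) auto
      then obtain p q where pq: "m' dvd q ^ 2 - 1" "m' dvd p ^ n - q * [:0, 1:]"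
        using less.hyps nz by blast
      have surj: "surj (\<lambda>f. poly (map_poly complex_of_real f) a)"
      proof (rule surjI)
        fix z
        show "poly (map_poly complex_of_real [:Re z - Im z / Im a * Re a, Im z / Im a:]) a = z"
          using False by (simp add: map_poly_pCons complex_eq_iff)
      qed
      obtain w where w: "w ^ n = 1 * poly (map_poly complex_of_real [:0, 1:]) a"
        using complex_root_exists \<open>n > 0\<close> by blast
      show ?thesis unfolding m'
        by (rule real_poly_lift_sign_root_step[OF _ _ _ surj _ pq \<open>n > 0\<close> _ _ w])
          (use False quadratic_dvd_of_nonreal_root[OF False, folded Q_def] in
            \<open>auto simp: map_poly_pCons map_poly_of_real_add map_poly_of_real_mult\<close>)
    qed
  qed
qed

section \<open>Polynomials in an operator on a finite-dimensional space\<close>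

locale fd_space = vector_space sc
  for sc :: "'k::field \<Rightarrow> 'a::ab_group_add \<Rightarrow> 'a" +
  fixes U :: "'a set"
  assumes subspace_U: "subspace U"
    and finitely_spanned: "\<exists>B. finite B \<and> U \<subseteq> span B"

definition endo_on :: "('k \<Rightarrow> 'a \<Rightarrow> 'a::ab_group_add) \<Rightarrow> 'a set \<Rightarrow> ('a \<Rightarrow> 'a) \<Rightarrow> bool" where
  "endo_on sc U T \<longleftrightarrow> (\<forall>x\<in>U. \<forall>y\<in>U. T (x + y) = T x + T y) \<and>
     (\<forall>c. \<forall>x\<in>U. T (sc c x) = sc c (T x)) \<and> (\<forall>x\<in>U. T x \<in> U)"

text \<open>
  The value of the polynomial \<open>p\<close> at the operator \<open>T\<close>, by Horner's scheme, so that \<open>pCons\<close> unfolds to a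
  single application of \<open>T\<close>.
\<close>

definition poly_op :: "('k::field \<Rightarrow> 'a \<Rightarrow> 'a::ab_group_add) \<Rightarrow> ('a \<Rightarrow> 'a) \<Rightarrow> 'k poly \<Rightarrow> 'a \<Rightarrow> 'a" where
  "poly_op sc T p = fold_coeffs (\<lambda>a f x. sc a x + T (f x)) p (\<lambda>x. 0)"

context fd_space
begin

lemma endo_onD:
  assumes "endo_on sc U T"
  shows "x \<in> U \<Longrightarrow> y \<in> U \<Longrightarrow> T (x + y) = T x + T y"
    and "x \<in> U \<Longrightarrow> T (sc c x) = sc c (T x)"
    and "x \<in> U \<Longrightarrow> T x \<in> U"
  using assms by (auto simp: endo_on_def)

lemma U_closed [simp]:
  "0 \<in> U" "x \<in> U \<Longrightarrow> y \<in> U \<Longrightarrow> x + y \<in> U" "x \<in> U \<Longrightarrow> y \<in> U \<Longrightarrow> x - y \<in> U"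
  "x \<in> U \<Longrightarrow> sc c x \<in> U" "x \<in> U \<Longrightarrow> - x \<in> U"
  using subspace_U
  by (auto intro: subspace_0 subspace_add subspace_diff subspace_scale subspace_neg)

lemma endo_zero: "endo_on sc U T \<Longrightarrow> T 0 = 0"
  using endo_onD(1)[of T 0 0] by simp

lemma endo_diff:
  assumes "endo_on sc U T" "x \<in> U" "y \<in> U"
  shows "T (x - y) = T x - T y"
  using endo_onD(1)[OF assms(1), of "x - y" y] assms by simp

lemma endo_compow: "endo_on sc U T \<Longrightarrow> endo_on sc U (T ^^ k)"
  by (induction k) (auto simp: endo_on_def)

lemma endo_inj_onI:
  assumes "endo_on sc U T" "\<And>x. x \<in> U \<Longrightarrow> T x = 0 \<Longrightarrow> x = 0"
  shows "inj_on T U"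
proof (rule inj_onI)
  fix x y assume "x \<in> U" "y \<in> U" "T x = T y"
  then show "x = y" using assms(2)[of "x - y"] endo_diff[OF assms(1)] by simp
qed

lemma poly_op_0 [simp]: "poly_op sc T 0 x = 0"
  by (simp add: poly_op_def)

lemma poly_op_pCons [simp]:
  assumes "endo_on sc U T"
  shows "poly_op sc T (pCons a p) x = sc a x + T (poly_op sc T p x)"
proof (cases "a = 0 \<and> p = 0")
  case True
  then show ?thesis using endo_zero[OF assms] by simp
next
  case False
  then show ?thesis by (cases "a = 0") (simp_all add: poly_op_def)
qed

lemma poly_op_closed [simp]:
  assumes "endo_on sc U T" "x \<in> U"
  shows "poly_op sc T p x \<in> U"
  by (induction p) (use assms endo_onD in auto)

lemma poly_op_endo:
  assumes "endo_on sc U T"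
  shows "endo_on sc U (poly_op sc T p)"
proof -
  have "poly_op sc T p (x + y) = poly_op sc T p x + poly_op sc T p y"
    if "x \<in> U" "y \<in> U" for x y
    using assms that
    by (induction p) (simp_all add: endo_onD[OF assms] scale_right_distrib)
  moreover have "poly_op sc T p (sc c x) = sc c (poly_op sc T p x)" if "x \<in> U" for c x
    using assms that
    by (induction p)
      (simp_all add: endo_onD(2)[OF assms, symmetric] scale_right_distrib scale_left_commute)
  ultimately show ?thesis using assms by (auto simp: endo_on_def)
qed

lemma poly_op_add:
  assumes "endo_on sc U T" "x \<in> U"
  shows "poly_op sc T (p + q) x = poly_op sc T p x + poly_op sc T q x"
  by (induction p q rule: poly_induct2)
    (simp_all add: assms endo_onD[OF assms(1)] scale_left_distrib)

lemma poly_op_smult: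
  assumes "endo_on sc U T" "x \<in> U"
  shows "poly_op sc T (smult c p) x = sc c (poly_op sc T p x)"
  by (induction p)
    (simp_all add: assms endo_onD(2)[OF assms(1)] scale_right_distrib)

lemma poly_op_diff:
  assumes "endo_on sc U T" "x \<in> U"
  shows "poly_op sc T (p - q) x = poly_op sc T p x - poly_op sc T q x"
  using poly_op_add[OF assms, of "p - q" q] by simp

lemma poly_op_mult:
  assumes "endo_on sc U T" "x \<in> U"
  shows "poly_op sc T (p * q) x = poly_op sc T p (poly_op sc T q x)"
  by (induction p) (simp_all add: assms poly_op_add poly_op_smult)

lemma poly_op_1: "endo_on sc U T \<Longrightarrow> poly_op sc T 1 x = x"
  by (simp add: one_pCons endo_zero)

lemma poly_op_X: "endo_on sc U T \<Longrightarrow> poly_op sc T [:0, 1:] x = T x"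
  by (simp add: endo_zero)

lemma poly_op_power:
  assumes "endo_on sc U T" "x \<in> U"
  shows "poly_op sc T (p ^ k) x = (poly_op sc T p ^^ k) x"
  by (induction k) (simp_all add: assms poly_op_mult poly_op_1)

lemma poly_op_commute:
  assumes "endo_on sc U T" "x \<in> U"
  shows "poly_op sc T p (poly_op sc T q x) = poly_op sc T q (poly_op sc T p x)"
  using poly_op_mult[OF assms, of p q] poly_op_mult[OF assms, of q p] by (simp add: mult.commute)

lemma poly_op_dvd:
  assumes "endo_on sc U T" "x \<in> U" "m dvd f" "poly_op sc T m x = 0"
  shows "poly_op sc T f x = 0"
proof -
  obtain k where "f = k * m" using assms(3) by (metis dvd_def mult.commute)
  then show ?thesis using assms endo_zero[OF poly_op_endo] by (simp add: poly_op_mult)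
qed

lemma poly_op_sum_monom:
  assumes "endo_on sc U T" "x \<in> U"
  shows "poly_op sc T (\<Sum>i<N. monom (c i) i) x = (\<Sum>i<N. sc (c i) ((T ^^ i) x))"
proof (induction N)
  case (Suc N)
  have "poly_op sc T (monom a k) x = sc a ((T ^^ k) x)" for a k
    by (induction k) (use assms endo_zero endo_onD(2,3)[OF endo_compow] endo_onD(2) in
        \<open>auto simp: monom_0 monom_Suc\<close>)
  then show ?case using Suc assms by (simp add: poly_op_add)
qed simp

text \<open>
  The iterates \<open>x, T x, T\<^sup>2 x, \<dots>\<close> are linearly dependent: two of the first \<open>card B + 1\<close> coincide or they
  are too many to be independent.
\<close>

lemma annihilating_poly_at:
  assumes T: "endo_on sc U T" and x: "x \<in> U"
  shows "\<exists>m. m \<noteq> 0 \<and> poly_op sc T m x = 0"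
proof -
  obtain B where B: "finite B" "U \<subseteq> span B" using finitely_spanned by blast
  define N where "N = Suc (card B)"
  define f where "f = (\<lambda>i. (T ^^ i) x)"
  have fU: "f i \<in> U" for i using endo_onD(3)[OF endo_compow[OF T] x] by (simp add: f_def)
  have "\<exists>c i. i < N \<and> c i \<noteq> 0 \<and> (\<Sum>i<N. sc (c i) (f i)) = 0"
  proof (cases "inj_on f {..<N}")
    case True
    have "dependent (f ` {..<N})"
    proof (rule ccontr)
      assume ind: "independent (f ` {..<N})"
      have "f ` {..<N} \<subseteq> span B" using fU B by blast
      then have "card (f ` {..<N}) \<le> card B"
        using independent_span_bound[OF B(1) ind] by simp
      then show False using True by (simp add: card_image N_def)
    qed
    then obtain u v where u: "v \<in> f ` {..<N}" "u v \<noteq> 0" "(\<Sum>v\<in>f ` {..<N}. sc (u v) v) = 0"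
      by (auto simp: dependent_finite)
    then obtain i where "i < N" "v = f i" by blast
    with u True show ?thesis
      by (intro exI[of _ "\<lambda>i. u (f i)"] exI[of _ i]) (simp add: sum.reindex o_def)
  next
    case False
    then obtain i j where ij: "i < N" "j < N" "i \<noteq> j" "f i = f j" by (auto simp: inj_on_def)
    define c where "c = (\<lambda>k. if k = i then 1 else if k = j then - 1 else 0 :: 'k)"
    have "(\<Sum>k<N. sc (c k) (f k)) = (\<Sum>k\<in>{i, j}. sc (c k) (f k))"
      by (rule sum.mono_neutral_right) (use ij in \<open>auto simp: c_def\<close>)
    also have "\<dots> = 0" using ij by (simp add: c_def)
    finally show ?thesis using ij by (intro exI[of _ c] exI[of _ i]) (auto simp: c_def)
  qed
  then obtain c i where c: "i < N" "c i \<noteq> 0" "(\<Sum>i<N. sc (c i) (f i)) = 0" by blast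
  define m where "m = (\<Sum>i<N. monom (c i) i)"
  have "coeff m i = c i" using c(1) by (simp add: m_def coeff_sum)
  then have "m \<noteq> 0" using c by auto
  moreover have "poly_op sc T m x = 0"
    unfolding m_def poly_op_sum_monom[OF T x] using c by (simp add: f_def)
  ultimately show ?thesis by blast
qed

lemma annihilating_poly:
  assumes T: "endo_on sc U T"
  shows "\<exists>m. m \<noteq> 0 \<and> (\<forall>x\<in>U. poly_op sc T m x = 0)"
proof -
  obtain B where B: "finite B" "U \<subseteq> span B" using finitely_spanned by blast
  obtain S where S: "S \<subseteq> U" "independent S" "U \<subseteq> span S"
    using basis_exists[of U] by metis
  have "finite S" 
    using independent_span_bound[OF B(1) S(2) order_trans[OF S(1) B(2)]] by simp
  then have "\<exists>m. m \<noteq> 0 \<and> (\<forall>x\<in>S. poly_op sc T m x = 0)" using S(1)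
  proof induction
    case empty
    then show ?case by (intro exI[of _ 1]) simp
  next
    case (insert b S)
    then obtain m where m: "m \<noteq> 0" "\<forall>x\<in>S. poly_op sc T m x = 0" by auto
    obtain k where k: "k \<noteq> 0" "poly_op sc T k b = 0"
      using annihilating_poly_at[OF T] insert.prems by blast
    have "\<forall>x\<in>insert b S. poly_op sc T (m * k) x = 0"
      using poly_op_dvd[OF T _ dvd_triv_left m(2)[rule_format]]
        poly_op_dvd[OF T _ dvd_triv_right k(2)] insert.prems by auto
    then show ?case using m k by (intro exI[of _ "m * k"]) simp
  qed
  then obtain m where m: "m \<noteq> 0" "\<forall>x\<in>S. poly_op sc T m x = 0" by blast
  have "subspace {x \<in> U. poly_op sc T m x = 0}"
    using endo_onD[OF poly_op_endo[OF T]] endo_zero[OF poly_op_endo[OF T]]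
    by (intro subspaceI) auto
  then have "span S \<subseteq> {x \<in> U. poly_op sc T m x = 0}"
    using m S by (intro span_minimal) auto
  then show ?thesis using m S by blast
qed

text \<open>
  Factors \<open>X\<close> can be cancelled from an annihilating polynomial of an injective operator.
\<close>

lemma annihilating_poly_nonzero_at_0:
  assumes T: "endo_on sc U T" and inj: "inj_on T U"
  shows "\<exists>m. poly m 0 \<noteq> 0 \<and> (\<forall>x\<in>U. poly_op sc T m x = 0)"
proof -
  have "m \<noteq> 0 \<Longrightarrow> \<forall>x\<in>U. poly_op sc T m x = 0 \<Longrightarrow> ?thesis" for m
  proof (induction m)
    case (pCons a m)
    show ?case
    proof (cases "a = 0")
      case True
      have "\<forall>x\<in>U. poly_op sc T m x = 0"
      proof
        fix x assume x: "x \<in> U"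
        then have "T (poly_op sc T m x) = T 0"
          using pCons.prems T endo_zero[OF T] True by simp
        then show "poly_op sc T m x = 0" using inj_onD[OF inj] x T by simp
      qed
      then show ?thesis using pCons True by auto
    next
      case False
      then show ?thesis using pCons.prems by (intro exI[of _ "pCons a m"]) simp
    qed
  qed simp
  then show ?thesis using annihilating_poly[OF T] by blast
qed

text \<open>
  An annihilating polynomial \<open>a + X p\<close> with \<open>a \<noteq> 0\<close> exhibits the inverse \<open>- p(T) / a\<close>.
\<close>

lemma endo_inj_imp_bij:
  assumes T: "endo_on sc U T" and inj: "inj_on T U"
  shows "bij_betw T U U"
proof -
  obtain m where m: "poly m 0 \<noteq> 0" "\<forall>x\<in>U. poly_op sc T m x = 0"
    using annihilating_poly_nonzero_at_0[OF assms] by blast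
  obtain a p where p: "m = pCons a p" by (cases m)
  have "y \<in> T ` U" if y: "y \<in> U" for y
  proof -
    have "sc a y + T (poly_op sc T p y) = 0" using m y p T by simp
    then have "sc (inverse a) (sc a y + T (poly_op sc T p y)) = 0" by simp
    moreover have "a \<noteq> 0" using m p by simp
    ultimately have "y + sc (inverse a) (T (poly_op sc T p y)) = 0"
      by (simp add: scale_right_distrib)
    then have "y = sc (- inverse a) (T (poly_op sc T p y))"
      by (simp add: eq_neg_iff_add_eq_0)
    also have "\<dots> = T (sc (- inverse a) (poly_op sc T p y))"
      using endo_onD(2)[OF T, of "poly_op sc T p y" "- inverse a"] y T by simp
    finally have "y = T (sc (- inverse a) (poly_op sc T p y))" .
    moreover have "sc (- inverse a) (poly_op sc T p y) \<in> U" using T y by simp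
    ultimately show ?thesis by blast
  qed
  then show ?thesis using inj endo_onD(3)[OF T] by (auto simp: bij_betw_def)
qed

end

section \<open>Self-adjoint operators and projections of a multilinear form\<close>

locale form_space = fd_space sc U
  for sc :: "'k::field \<Rightarrow> 'a::ab_group_add \<Rightarrow> 'a" and U +
  fixes n :: nat and F :: "(nat \<Rightarrow> 'a) \<Rightarrow> 'k"
  assumes n2: "2 \<le> n"
    and multilinear: "multilinear_form n sc U F"

definition self_adjoint ::
  "nat \<Rightarrow> ('k::field \<Rightarrow> 'a::ab_group_add \<Rightarrow> 'a) \<Rightarrow> 'a set \<Rightarrow> ((nat \<Rightarrow> 'a) \<Rightarrow> 'k) \<Rightarrow> ('a \<Rightarrow> 'a) \<Rightarrow> bool"
where
  "self_adjoint n sc U F T \<longleftrightarrow> endo_on sc U T \<and>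
     (\<forall>u\<in>tuples n U. \<forall>i<n. \<forall>j<n. F (u(i := T (u i))) = F (u(j := T (u j))))"

text \<open>
  These are the projections of the decompositions \<open>F = F\<^sub>1 \<oplus> F\<^sub>2\<close>: the summands live on the image and the
  kernel of \<open>e\<close>. Working with \<open>e\<close> makes operations on decompositions compositions of operators.
\<close>

definition form_projection ::
  "nat \<Rightarrow> ('k::field \<Rightarrow> 'a::ab_group_add \<Rightarrow> 'a) \<Rightarrow> 'a set \<Rightarrow> ((nat \<Rightarrow> 'a) \<Rightarrow> 'k) \<Rightarrow> ('a \<Rightarrow> 'a) \<Rightarrow> bool"
where
  "form_projection n sc U F e \<longleftrightarrow> self_adjoint n sc U F e \<and> (\<forall>x\<in>U. e (e x) = e x)"

abbreviation tmap :: "nat \<Rightarrow> ('a \<Rightarrow> 'b) \<Rightarrow> (nat \<Rightarrow> 'a) \<Rightarrow> nat \<Rightarrow> 'b" where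
  "tmap n f u \<equiv> (\<lambda>k\<in>{..<n}. f (u k))"

lemma tuples_upd: "u \<in> tuples n U \<Longrightarrow> i < n \<Longrightarrow> x \<in> U \<Longrightarrow> u(i := x) \<in> tuples n U"
  by (auto simp: PiE_iff extensional_def)

lemma tuples_mem: "u \<in> tuples n U \<Longrightarrow> i < n \<Longrightarrow> u i \<in> U"
  by auto

lemma tuples_mono: "u \<in> tuples n A \<Longrightarrow> A \<subseteq> U \<Longrightarrow> u \<in> tuples n U"
  by (auto simp: PiE_iff)

lemma tmap_tuples: "u \<in> tuples n U \<Longrightarrow> (\<And>x. x \<in> U \<Longrightarrow> f x \<in> A) \<Longrightarrow> tmap n f u \<in> tuples n A"
  by (auto simp: PiE_iff)

lemma tmap_id: "u \<in> tuples n U \<Longrightarrow> (\<And>x. x \<in> U \<Longrightarrow> f x = x) \<Longrightarrow> tmap n f u = u"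
  by (auto simp: PiE_iff extensional_def)

lemma tmap_tmap: "tmap n f (tmap n g u) = tmap n (\<lambda>x. f (g x)) u"
  by auto

lemma tmap_upd: "i < n \<Longrightarrow> tmap n f (u(i := x)) = (tmap n f u)(i := f x)"
  by (auto simp: fun_eq_iff restrict_def)

context form_space
begin

lemma F_add:
  assumes "u \<in> tuples n U" "i < n" "x \<in> U" "y \<in> U"
  shows "F (u(i := x + y)) = F (u(i := x)) + F (u(i := y))"
  using multilinear assms unfolding multilinear_form_def linear_on_def by blast

lemma F_scale:
  assumes "u \<in> tuples n U" "i < n" "x \<in> U"
  shows "F (u(i := sc c x)) = c * F (u(i := x))"
  using multilinear assms unfolding multilinear_form_def linear_on_def by blast

lemma F_zero: "u \<in> tuples n U \<Longrightarrow> i < n \<Longrightarrow> F (u(i := 0)) = 0"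
  using F_scale[of u i 0 0] by simp

lemma sa_endo: "self_adjoint n sc U F T \<Longrightarrow> endo_on sc U T"
  by (simp add: self_adjoint_def)

lemma sa_closed: "self_adjoint n sc U F T \<Longrightarrow> x \<in> U \<Longrightarrow> T x \<in> U"
  by (auto dest: sa_endo simp: endo_on_def)

lemma sa_zero: "self_adjoint n sc U F T \<Longrightarrow> T 0 = 0"
  by (simp add: sa_endo endo_zero)

lemma saD:
  assumes "self_adjoint n sc U F T" "u \<in> tuples n U" "i < n" "j < n"
  shows "F (u(i := T (u i))) = F (u(j := T (u j)))"
  using assms unfolding self_adjoint_def by blast

lemma sa_cong:
  assumes "self_adjoint n sc U F T" "\<And>x. x \<in> U \<Longrightarrow> T x = S x"
  shows "self_adjoint n sc U F S"
proof -
  have "F (u(i := S (u i))) = F (u(i := T (u i)))" if "u \<in> tuples n U" "i < n" for u i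
    using assms(2) tuples_mem[OF that] by simp
  moreover have "endo_on sc U S"
    using sa_endo[OF assms(1)] assms(2) by (simp add: endo_on_def)
  ultimately show ?thesis
    using saD[OF assms(1)] unfolding self_adjoint_def by metis
qed

lemma sa_id: "self_adjoint n sc U F (\<lambda>x. x)"
  by (simp add: self_adjoint_def endo_on_def)

lemma sa_add:
  assumes "self_adjoint n sc U F S" "self_adjoint n sc U F T"
  shows "self_adjoint n sc U F (\<lambda>x. S x + T x)"
  unfolding self_adjoint_def
proof (intro conjI ballI allI impI)
  show "endo_on sc U (\<lambda>x. S x + T x)"
    using assms[THEN sa_endo] by (simp add: endo_on_def scale_right_distrib)
  fix u i j assume "u \<in> tuples n U" "i < n" "j < n"
  then show "F (u(i := S (u i) + T (u i))) = F (u(j := S (u j) + T (u j)))"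
    using assms saD[of S u i j] saD[of T u i j] by (simp add: F_add sa_closed tuples_mem)
qed

lemma sa_scale:
  assumes "self_adjoint n sc U F T"
  shows "self_adjoint n sc U F (\<lambda>x. sc c (T x))"
  unfolding self_adjoint_def
proof (intro conjI ballI allI impI)
  show "endo_on sc U (\<lambda>x. sc c (T x))"
    using assms[THEN sa_endo] by (simp add: endo_on_def scale_right_distrib scale_left_commute)
  fix u i j assume "u \<in> tuples n U" "i < n" "j < n"
  then show "F (u(i := sc c (T (u i)))) = F (u(j := sc c (T (u j))))"
    using assms saD[of T u i j] by (simp add: F_scale sa_closed tuples_mem)
qed

lemma sa_diff:
  assumes "self_adjoint n sc U F S" "self_adjoint n sc U F T"
  shows "self_adjoint n sc U F (\<lambda>x. S x - T x)"
  by (rule sa_cong[OF sa_add[OF assms(1) sa_scale[OF assms(2), of "- 1"]]]) simp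

text \<open>
  The two operators are moved to another argument one after the other, which reverses their order.
\<close>

lemma sa_comp:
  assumes S: "self_adjoint n sc U F S" and T: "self_adjoint n sc U F T"
    and comm: "\<And>x. x \<in> U \<Longrightarrow> S (T x) = T (S x)"
  shows "self_adjoint n sc U F (\<lambda>x. S (T x))"
  unfolding self_adjoint_def
proof (intro conjI ballI allI impI)
  show "endo_on sc U (\<lambda>x. S (T x))"
    using S[THEN sa_endo] T[THEN sa_endo] by (simp add: endo_on_def)
  fix u i j assume u: "u \<in> tuples n U" "i < n" "j < n"
  show "F (u(i := S (T (u i)))) = F (u(j := S (T (u j))))"
  proof (cases "i = j")
    case False
    note mem = tuples_mem[OF u(1)] sa_closed[OF S] sa_closed[OF T]
    have "F (u(i := S (T (u i)))) = F ((u(i := T (u i)))(j := S (u j)))"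
      using saD[OF S, of "u(i := T (u i))" i j] u mem False by (simp add: tuples_upd)
    also have "\<dots> = F ((u(j := S (u j)))(i := T (u i)))"
      using False by (simp add: fun_upd_twist)
    also have "\<dots> = F (u(j := T (S (u j))))"
      using saD[OF T, of "u(j := S (u j))" i j] u mem False by (simp add: tuples_upd)
    finally show ?thesis using comm mem u by simp
  qed simp
qed

text \<open>
  Moving the three factors to another argument reverses their order, and the product is a palindrome.
  In this way self-adjoint operators can be normalised by conjugation with a square root although
  products of self-adjoint operators are not self-adjoint in general.
\<close>

lemma sa_sandwich:
  assumes S: "self_adjoint n sc U F S" and T: "self_adjoint n sc U F T"
  shows "self_adjoint n sc U F (\<lambda>x. S (T (S x)))"
  unfolding self_adjoint_def
proof (intro conjI ballI allI impI)
  show "endo_on sc U (\<lambda>x. S (T (S x)))"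
    using assms[THEN sa_endo] by (simp add: endo_on_def)
  fix u i j assume u: "u \<in> tuples n U" "i < n" "j < n"
  show "F (u(i := S (T (S (u i))))) = F (u(j := S (T (S (u j)))))"
  proof (cases "i = j")
    case False
    note mem = tuples_mem[OF u(1)] sa_closed[OF S] sa_closed[OF T]
    have "F (u(i := S (T (S (u i))))) = F (u(i := T (S (u i)), j := S (u j)))"
      using saD[OF S, of "u(i := T (S (u i)))" i j] u mem False by (simp add: tuples_upd)
    also have "\<dots> = F (u(i := S (u i), j := T (S (u j))))"
      using saD[OF T, of "u(i := S (u i), j := S (u j))" i j] u mem False
      by (simp add: tuples_upd fun_upd_twist)
    also have "\<dots> = F (u(j := T (S (u j)), i := S (u i)))"
      using False by (simp add: fun_upd_twist)
    also have "\<dots> = F (u(j := S (T (S (u j)))))"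
      using saD[OF S, of "u(j := T (S (u j)))" i j] u mem False by (simp add: tuples_upd)
    finally show ?thesis .
  qed simp
qed

lemma sa_poly_op:
  assumes T: "self_adjoint n sc U F T"
  shows "self_adjoint n sc U F (poly_op sc T p)"
proof (induction p)
  case 0
  show ?case by (rule sa_cong[OF sa_scale[OF sa_id, of 0]]) simp
next
  case (pCons a p)
  note E = sa_endo[OF T]
  have "T (poly_op sc T p x) = poly_op sc T p (T x)" if "x \<in> U" for x
    using poly_op_commute[OF E that, of "[:0, 1:]" p] E by (simp add: endo_zero)
  then have "self_adjoint n sc U F (\<lambda>x. T (poly_op sc T p x))"
    by (rule sa_comp[OF T pCons.IH])
  from sa_add[OF sa_scale[OF sa_id, of a] this] show ?case
    by (rule sa_cong) (simp add: E)
qed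

lemma sa_compow:
  assumes "self_adjoint n sc U F T"
  shows "self_adjoint n sc U F (T ^^ k)"
proof (rule sa_cong[OF sa_poly_op[OF assms, of "[:0, 1:] ^ k"]])
  have "(poly_op sc T [:0, 1:] ^^ k) x = (T ^^ k) x" for x
    using sa_endo[OF assms] by (induction k) (simp_all add: poly_op_X endo_zero)
  then show "poly_op sc T ([:0, 1:] ^ k) x = (T ^^ k) x" if "x \<in> U" for x
    using poly_op_power[OF sa_endo[OF assms] that] by simp
qed

text \<open>
  The identity behind both parts of the theorem: a twist by an \<open>n\<close>-th power is a congruence.
\<close>

lemma sa_power_distribute:
  assumes R: "self_adjoint n sc U F R" and u: "u \<in> tuples n U" and i: "i < n"
  shows "F (u(i := (R ^^ n) (u i))) = F (tmap n R u)"
proof -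
  have "F (u(i := (R ^^ card S) (u i))) = F (\<lambda>k. if k \<in> S then R (u k) else u k)"
    if "S \<subseteq> {..<n}" for S
  proof -
    from that have "finite S" by (simp add: finite_subset)
    then show ?thesis using that u
    proof (induction S arbitrary: u)
      case empty
      then show ?case by simp
    next
      case (insert k S)
      define u' where "u' = u(k := R (u k))"
      have u': "u' \<in> tuples n U"
        unfolding u'_def using insert.prems by (intro tuples_upd sa_closed[OF R]) auto
      define v where "v = u(i := (R ^^ card S) (u i))"
      have v: "v \<in> tuples n U"
        unfolding v_def using insert.prems i sa_closed[OF sa_compow[OF R]]
        by (intro tuples_upd) auto
      have "u(i := (R ^^ card (insert k S)) (u i)) = v(i := R (v i))"
        using insert.hyps by (simp add: v_def)
      moreover have "v(k := R (v k)) = u'(i := (R ^^ card S) (u' i))"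
        by (auto simp: v_def u'_def fun_eq_iff simp flip: funpow_swap1)
      ultimately have "F (u(i := (R ^^ card (insert k S)) (u i)))
          = F (u'(i := (R ^^ card S) (u' i)))"
        using saD[OF R v i, of k] insert.prems by simp
      also have "\<dots> = F (\<lambda>l. if l \<in> S then R (u' l) else u' l)"
        using insert.IH[OF _ u'] insert.prems by blast
      also have "(\<lambda>l. if l \<in> S then R (u' l) else u' l)
          = (\<lambda>l. if l \<in> insert k S then R (u l) else u l)"
        using insert.hyps by (auto simp: u'_def)
      finally show ?case .
    qed
  qed
  from this[of "{..<n}"] have "F (u(i := (R ^^ n) (u i)))
      = F (\<lambda>k. if k \<in> {..<n} then R (u k) else u k)" by simp
  also have "(\<lambda>k. if k \<in> {..<n} then R (u k) else u k) = tmap n R u"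
    using u by (auto simp: fun_eq_iff PiE_iff extensional_def)
  finally show ?thesis .
qed

lemma form_space_subspace:
  assumes "subspace A" "A \<subseteq> U"
  shows "form_space sc A n F"
proof unfold_locales
  show "\<exists>B. finite B \<and> A \<subseteq> span B" using finitely_spanned assms(2) by blast
  show "multilinear_form n sc A F"
    unfolding multilinear_form_def linear_on_def
    using F_add[OF tuples_mono[OF _ assms(2)]] F_scale[OF tuples_mono[OF _ assms(2)]]
      subsetD[OF assms(2)] by simp
qed (use assms n2 in auto)

lemma proj_sa: "form_projection n sc U F e \<Longrightarrow> self_adjoint n sc U F e"
  by (simp add: form_projection_def)

lemma proj_idem: "form_projection n sc U F e \<Longrightarrow> x \<in> U \<Longrightarrow> e (e x) = e x"
  by (simp add: form_projection_def)

lemma proj_image_iff: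
  assumes "form_projection n sc U F e"
  shows "x \<in> e ` U \<longleftrightarrow> x \<in> U \<and> e x = x"
  using proj_idem[OF assms] sa_closed[OF proj_sa[OF assms]] by force

lemma proj_complement:
  assumes "form_projection n sc U F e"
  shows "form_projection n sc U F (\<lambda>x. x - e x)"
  using sa_diff[OF sa_id proj_sa[OF assms]] proj_idem[OF assms]
    endo_diff[OF sa_endo[OF proj_sa[OF assms]]] sa_closed[OF proj_sa[OF assms]]
  by (simp add: form_projection_def)

lemma proj_complement_image:
  assumes "form_projection n sc U F e"
  shows "(\<lambda>x. x - e x) ` U = {x \<in> U. e x = 0}"
  using proj_image_iff[OF proj_complement[OF assms]] by auto

lemma endo_image_subspace: "endo_on sc U T \<Longrightarrow> subspace (T ` U)"
proof (rule subspaceI)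
  assume T: "endo_on sc U T"
  show "0 \<in> T ` U" using endo_zero[OF T] U_closed(1) by (metis imageI)
  show "\<And>x y. x \<in> T ` U \<Longrightarrow> y \<in> T ` U \<Longrightarrow> x + y \<in> T ` U"
    using endo_onD(1)[OF T] U_closed(2) by (metis (no_types, lifting) imageE imageI)
  show "\<And>c x. x \<in> T ` U \<Longrightarrow> sc c x \<in> T ` U"
    using endo_onD(2)[OF T] U_closed(4) by (metis (no_types, lifting) imageE imageI)
qed

lemma proj_image_space:
  assumes "form_projection n sc U F e"
  shows "form_space sc (e ` U) n F"
  by (rule form_space_subspace[OF endo_image_subspace])
    (use sa_closed[OF proj_sa[OF assms]] sa_endo[OF proj_sa[OF assms]] in auto)

lemma proj_kernel_space:
  assumes "form_projection n sc U F e"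
  shows "form_space sc {x \<in> U. e x = 0} n F"
  using proj_image_space[OF proj_complement[OF assms]] proj_complement_image[OF assms] by simp

lemma proj_compow:
  assumes "form_projection n sc U F e" "x \<in> U" "k > 0"
  shows "(e ^^ k) x = e x"
  using assms(3)
proof (induction k)
  case (Suc k)
  then show ?case using assms proj_idem by (cases k) auto
qed simp

lemma proj_distribute:
  assumes e: "form_projection n sc U F e" and u: "u \<in> tuples n U" and i: "i < n"
  shows "F (u(i := e (u i))) = F (tmap n e u)"
  using sa_power_distribute[OF proj_sa[OF e] u i] proj_compow[OF e tuples_mem[OF u i], of n] n2
  by simp

lemma proj_expand:
  assumes e: "form_projection n sc U F e" and u: "u \<in> tuples n U"
  shows "F u = F (tmap n e u) + F (tmap n (\<lambda>x. x - e x) u)"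
proof -
  have 0: "0 < n" using n2 by simp
  have "F u = F (u(0 := e (u 0) + (u 0 - e (u 0))))" by simp
  also have "\<dots> = F (u(0 := e (u 0))) + F (u(0 := u 0 - e (u 0)))"
    using u 0 by (intro F_add U_closed sa_closed[OF proj_sa[OF e]] tuples_mem[OF u])
  finally show ?thesis
    using proj_distribute[OF e u 0] proj_distribute[OF proj_complement[OF e] u 0] by simp
qed

text \<open>
  If the other arguments lie in the image of \<open>e\<close>, one of them can lend its factor \<open>e\<close>; this is where
  \<open>n \<ge> 2\<close> enters.
\<close>

lemma proj_compress_slot:
  assumes e: "form_projection n sc U F e" and u: "u \<in> tuples n (e ` U)" and i: "i < n"
    and x: "x \<in> U"
  shows "F (u(i := e x)) = F (u(i := x))"
proof -
  define j :: nat where "j = (if i = 0 then 1 else 0)"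
  have j: "j < n" "j \<noteq> i" using n2 by (auto simp: j_def)
  have sub: "e ` U \<subseteq> U" using proj_image_iff[OF e] by blast
  have uU: "u \<in> tuples n U" using u sub tuples_mono by blast
  have "e (u j) = u j" using proj_image_iff[OF e] tuples_mem[OF u j(1)] by blast
  then have "(u(i := x))(j := e ((u(i := x)) j)) = u(i := x)" using j by auto
  then show ?thesis
    using saD[OF proj_sa[OF e] tuples_upd[OF uU i x] i j(1)] by simp
qed

lemma proj_compress_sa:
  assumes e: "form_projection n sc U F e" and T: "self_adjoint n sc U F T"
  shows "self_adjoint n sc (e ` U) F (\<lambda>x. e (T x))"
  unfolding self_adjoint_def
proof (intro conjI ballI allI impI)
  have sub: "e ` U \<subseteq> U" using proj_image_iff[OF e] by blast
  note E = endo_onD[OF sa_endo[OF proj_sa[OF e]]] endo_onD[OF sa_endo[OF T]]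
  show "endo_on sc (e ` U) (\<lambda>x. e (T x))"
    unfolding endo_on_def using subsetD[OF sub] E by simp
  fix u i j assume u: "u \<in> tuples n (e ` U)" and ij: "i < n" "j < n"
  have uU: "u \<in> tuples n U" using u sub tuples_mono by blast
  show "F (u(i := e (T (u i)))) = F (u(j := e (T (u j))))"
    using saD[OF T uU ij] proj_compress_slot[OF e u] ij E(6) tuples_mem[OF uU] by simp
qed

text \<open>
  As \<open>T (e x)\<close> is fixed by \<open>e\<close>, the factor \<open>e\<close> can be distributed to all arguments, after which \<open>T\<close>
  acts as an operator of the form on the image of \<open>e\<close>.
\<close>

lemma proj_extend_sa:
  assumes e: "form_projection n sc U F e" and T: "self_adjoint n sc (e ` U) F T"
  shows "self_adjoint n sc U F (\<lambda>x. T (e x))"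
  unfolding self_adjoint_def
proof (intro conjI ballI allI impI)
  have sub: "e ` U \<subseteq> U" using proj_image_iff[OF e] by blast
  note E = endo_onD[OF sa_endo[OF proj_sa[OF e]]]
  have TE: "endo_on sc (e ` U) T" using T unfolding self_adjoint_def by blast
  show "endo_on sc U (\<lambda>x. T (e x))"
    using TE sub E by (auto simp: endo_on_def)
  have Te: "T (e x) \<in> U" "e (T (e x)) = T (e x)" if "x \<in> U" for x
    using TE that proj_image_iff[OF e] by (auto simp: endo_on_def)
  have slot: "F (u(i := T (e (u i)))) = F ((tmap n e u)(i := T ((tmap n e u) i)))"
    if u: "u \<in> tuples n U" and i: "i < n" for u i
  proof -
    have ui: "u(i := T (e (u i))) \<in> tuples n U"
      using tuples_upd[OF u i] Te tuples_mem[OF u i] by simp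
    have "F (u(i := T (e (u i)))) = F (tmap n e (u(i := T (e (u i)))))"
      using proj_distribute[OF e ui i] Te tuples_mem[OF u i] by simp
    then show ?thesis
      unfolding tmap_upd[OF i] using Te(2) tuples_mem[OF u i] i by simp
  qed
  fix u i j assume u: "u \<in> tuples n U" and ij: "i < n" "j < n"
  have "tmap n e u \<in> tuples n (e ` U)" using u by (auto intro: tmap_tuples)
  then show "F (u(i := T (e (u i)))) = F (u(j := T (e (u j))))"
    using slot[OF u ij(1)] slot[OF u ij(2)] ij T unfolding self_adjoint_def by metis
qed

end

section \<open>Decompositions into indecomposable summands\<close>

context form_space
begin

lemma F_sum:
  assumes "u \<in> tuples n U" "i < n" "\<And>q. q \<in> I \<Longrightarrow> f q \<in> U"
  shows "F (u(i := sum f I)) = (\<Sum>q\<in>I. F (u(i := f q)))"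
proof -
  define g where "g x = F (u(i := x))" for x
  have g: "g 0 = 0" "\<And>x y. x \<in> U \<Longrightarrow> y \<in> U \<Longrightarrow> g (x + y) = g x + g y"
    using F_zero[OF assms(1,2)] F_add[OF assms(1,2)] by (simp_all only: g_def)
  have "g (sum f I) = (\<Sum>q\<in>I. g (f q))"
    using assms(3)
  proof (induction I rule: infinite_finite_induct)
    case (insert q I)
    then have "sum f I \<in> U" using subspace_U by (intro subspace_sum) auto
    then show ?case using insert g by simp
  qed (simp_all add: g)
  then show ?thesis by (simp only: g_def)
qed

lemma proj_mixed_zero:
  assumes e: "form_projection n sc U F e" and u: "u \<in> tuples n U" and ij: "i < n" "j < n"
    and "e (u i) = u i" "e (u j) = 0"
  shows "F u = 0"
  using saD[OF proj_sa[OF e] u ij] F_zero[OF u ij(2)] assms(5,6) by simp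

lemma proj_imp_direct_sum:
  assumes e: "form_projection n sc U F e"
  shows "form_direct_sum n sc U F 2 (\<lambda>p. if p = 0 then e ` U else {x \<in> U. e x = 0})"
    (is "form_direct_sum n sc U F 2 ?W")
proof -
  note im = proj_image_iff[OF e] and E = endo_onD[OF sa_endo[OF proj_sa[OF e]]]
  have sum2: "(\<Sum>p<2::nat. w p) = w 0 + w 1" for w :: "nat \<Rightarrow> 'a"
    by (simp add: numeral_2_eq_2)
  have W2: "w \<in> Pi\<^sub>E {..<2} ?W \<longleftrightarrow> w \<in> extensional {..<2} \<and> w 0 \<in> e ` U \<and> w 1 \<in> U \<and> e (w 1) = 0"
    for w by (auto simp: PiE_iff less_2_cases_iff)
  have "subspace (?W p)" if "p < 2" for p
    using that endo_image_subspace[OF sa_endo[OF proj_sa[OF e]]]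
      endo_image_subspace[OF sa_endo[OF proj_sa[OF proj_complement[OF e]]]]
      proj_complement_image[OF e] by simp
  moreover have "bij_betw (\<lambda>w. \<Sum>p<2. w p) (Pi\<^sub>E {..<2} ?W) U"
  proof (rule bij_betwI')
    fix w w' assume w: "w \<in> Pi\<^sub>E {..<2} ?W" "w' \<in> Pi\<^sub>E {..<2} ?W"
    show "(sum w {..<2} = sum w' {..<2}) = (w = w')"
    proof
      assume eq: "sum w {..<2} = sum w' {..<2}"
      then have "e (w 0 + w 1) = e (w' 0 + w' 1)" by (simp add: sum2)
      then have "w 0 = w' 0" using w E im by (simp add: W2)
      then have "w p = w' p" for p
        using w eq by (cases "p < 2") (auto simp: W2 sum2 less_2_cases_iff extensional_def)
      then show "w = w'" by blast
    qed simp
  next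
    fix w assume "w \<in> Pi\<^sub>E {..<2} ?W"
    then show "sum w {..<2} \<in> U" using im by (simp add: W2 sum2)
  next
    fix x assume x: "x \<in> U"
    let ?w = "\<lambda>p\<in>{..<2::nat}. if p = 0 then e x else x - e x"
    have "?w \<in> Pi\<^sub>E {..<2} ?W"
      unfolding W2 using x E proj_idem[OF e] endo_diff[OF sa_endo[OF proj_sa[OF e]]] by simp
    moreover have "x = sum ?w {..<2}" using sum2[of ?w] by simp
    ultimately show "\<exists>w\<in>Pi\<^sub>E {..<2} ?W. x = sum w {..<2}" by blast
  qed
  moreover have "F x = 0"
    if x: "x \<in> tuples n U" "i < n" "j < n" "p < 2" "q < 2" "x i \<in> ?W p" "x j \<in> ?W q" "p \<noteq> q"
    for x i j p q
    using x proj_mixed_zero[OF e x(1), of i j] proj_mixed_zero[OF e x(1), of j i] im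
    by (auto split: if_splits)
  ultimately show ?thesis unfolding form_direct_sum_def subspace_direct_sum_def by blast
qed

text \<open>
  The component maps are self-adjoint because \<open>F (\<dots>, E p x, \<dots>, y, \<dots>)\<close> only sees the \<open>p\<close>-th component of
  \<open>y\<close>: the remaining components give mixed terms.
\<close>

lemma direct_sum_projections:
  assumes W: "form_direct_sum n sc U F k W"
  obtains E where "\<And>p. p < k \<Longrightarrow> form_projection n sc U F (E p)"
    "\<And>p. p < k \<Longrightarrow> E p ` U = W p"
    "\<And>x. x \<in> U \<Longrightarrow> (\<Sum>p<k. E p x) = x"
    "\<And>p q x. p < k \<Longrightarrow> q < k \<Longrightarrow> p \<noteq> q \<Longrightarrow> x \<in> U \<Longrightarrow> E p (E q x) = 0"
proof -
  let ?P = "Pi\<^sub>E {..<k} W" and ?s = "\<lambda>w. \<Sum>p<k. w p"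
  have sub: "subspace (W p)" if "p < k" for p
    using W that by (simp add: form_direct_sum_def subspace_direct_sum_def)
  have bij: "bij_betw ?s ?P U"
    using W by (simp add: form_direct_sum_def subspace_direct_sum_def)
  have mixed: "F x = 0" if "x \<in> tuples n U" "i < n" "j < n" "p < k" "q < k" "x i \<in> W p" "x j \<in> W q"
    "p \<noteq> q" for x i j p q
    using W that unfolding form_direct_sum_def by blast
  define D where "D = inv_into ?P ?s"
  define E where "E = (\<lambda>p x. D x p)"
  have DP: "D x \<in> ?P" and Ds: "?s (D x) = x" if "x \<in> U" for x
    using that bij unfolding D_def
    by (metis bij_betw_def inv_into_into, metis bij_betw_inv_into_right)
  have Dw: "D (?s w) = w" if "w \<in> ?P" for w
    using that bij unfolding D_def by (metis bij_betw_inv_into_left)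
  have EW: "E p x \<in> W p" if "x \<in> U" "p < k" for p x
    using DP[OF that(1)] that(2) by (auto simp: E_def)
  have single: "E q x = (if q = p then x else 0) \<and> x \<in> U" if x: "x \<in> W p" "p < k" "q < k" for p q x
  proof -
    let ?w = "\<lambda>q\<in>{..<k}. if q = p then x else 0"
    have w: "?w \<in> ?P" using x sub by (auto simp: subspace_0)
    have s: "?s ?w = x" using x(2) by simp
    show ?thesis using Dw[OF w] s bij_betwE[OF bij] w x(3) unfolding E_def by fastforce
  qed
  have EU: "E p x \<in> U" if "x \<in> U" "p < k" for p x
    using single[OF EW[OF that] that(2,2)] by blast
  have add: "E p (x + y) = E p x + E p y" if xy: "x \<in> U" "y \<in> U" "p < k" for p x y
  proof -
    let ?w = "\<lambda>p\<in>{..<k}. E p x + E p y"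
    have w: "?w \<in> ?P" using sub EW xy by (auto intro: subspace_add)
    have s: "?s ?w = x + y" using Ds[OF xy(1)] Ds[OF xy(2)] by (simp add: E_def sum.distrib)
    have "E p (x + y) = ?w p" by (subst E_def) (simp only: Dw[OF w, unfolded s])
    then show ?thesis using xy(3) by simp
  qed
  have scale: "E p (sc c x) = sc c (E p x)" if x: "x \<in> U" "p < k" for p c x
  proof -
    let ?w = "\<lambda>p\<in>{..<k}. sc c (E p x)"
    have w: "?w \<in> ?P" using sub EW x by (auto intro: subspace_scale)
    have s: "?s ?w = sc c x" using Ds[OF x(1)] by (simp add: E_def flip: scale_sum_right)
    have "E p (sc c x) = ?w p" by (subst E_def) (simp only: Dw[OF w, unfolded s])
    then show ?thesis using x(2) by simp
  qed
  have total: "(\<Sum>p<k. E p x) = x" if "x \<in> U" for x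
    using Ds[OF that] by (simp add: E_def)
  have sa: "self_adjoint n sc U F (E p)" if p: "p < k" for p
    unfolding self_adjoint_def
  proof (intro conjI ballI allI impI)
    show "endo_on sc U (E p)" using add scale EU p by (simp add: endo_on_def)
    have slot: "F (u(i := E p (u i))) = F (u(i := E p (u i), j := E p (u j)))"
      if u: "u \<in> tuples n U" "i < n" "j < n" "i \<noteq> j" for u i j
    proof -
      let ?v = "u(i := E p (u i))"
      note mem = tuples_mem[OF u(1)]
      have v: "?v \<in> tuples n U" by (rule tuples_upd[OF u(1,2) EU[OF mem[OF u(2)] p]])
      have "F ?v = F (?v(j := \<Sum>q<k. E q (u j)))"
        using total[OF mem[OF u(3)]] u(4) by (metis fun_upd_other fun_upd_triv)
      also have "\<dots> = (\<Sum>q<k. F (?v(j := E q (u j))))"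
        using EU[OF mem[OF u(3)]] by (intro F_sum[OF v u(3)]) simp
      also have "\<dots> = (\<Sum>q\<in>{p}. F (?v(j := E q (u j))))"
      proof (rule sum.mono_neutral_right)
        show "\<forall>q\<in>{..<k} - {p}. F (?v(j := E q (u j))) = 0"
        proof
          fix q assume q: "q \<in> {..<k} - {p}"
          have t: "?v(j := E q (u j)) \<in> tuples n U"
            using q EU[OF mem[OF u(3)], of q] by (intro tuples_upd[OF v u(3)]) simp
          show "F (?v(j := E q (u j))) = 0"
            by (rule mixed[OF t u(2,3) p, of q])
              (use q u(4) EW[OF mem[OF u(2)] p] EW[OF mem[OF u(3)], of q] in simp_all)
        qed
      qed (use p in auto)
      finally show ?thesis by simp
    qed
    fix u i j assume u: "u \<in> tuples n U" "i < n" "j < n"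
    show "F (u(i := E p (u i))) = F (u(j := E p (u j)))"
    proof (cases "i = j")
      case False
      show ?thesis
        unfolding slot[OF u False] slot[OF u(1,3,2) False[symmetric]]
        by (simp only: fun_upd_twist[OF False])
    qed simp
  qed
  have "form_projection n sc U F (E p)" if "p < k" for p
    using sa[OF that] single[OF EW[OF _ that] that that] unfolding form_projection_def by simp
  moreover have "E p ` U = W p" if "p < k" for p
  proof (intro equalityI subsetI)
    fix x assume "x \<in> W p"
    then have "E p x = x" "x \<in> U" using single[OF _ that that] by auto
    then show "x \<in> E p ` U" by (metis imageI)
  qed (use EW[OF _ that] in auto)
  moreover have "E p (E q x) = 0" if "p < k" "q < k" "p \<noteq> q" "x \<in> U" for p q x
    using single[OF EW[OF that(4,2)] that(2,1)] that(3) by simp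
  ultimately show ?thesis using that total by blast
qed

lemma indecomposable_iff:
  "indecomposable_form n sc U F \<longleftrightarrow>
    (\<forall>e. form_projection n sc U F e \<longrightarrow> (\<forall>x\<in>U. e x = 0) \<or> (\<forall>x\<in>U. e x = x))"
proof (intro iffI allI impI)
  fix e assume "indecomposable_form n sc U F" and e: "form_projection n sc U F e"
  then have "e ` U = {0} \<or> {x \<in> U. e x = 0} = {0}"
    unfolding indecomposable_form_def using proj_imp_direct_sum[OF e] by fastforce
  then show "(\<forall>x\<in>U. e x = 0) \<or> (\<forall>x\<in>U. e x = x)"
  proof
    assume k: "{x \<in> U. e x = 0} = {0}"
    have "x - e x \<in> {x \<in> U. e x = 0}" if "x \<in> U" for x
      using that proj_complement_image[OF e] by blast
    then show ?thesis unfolding k by simp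
  qed blast
next
  assume *: "\<forall>e. form_projection n sc U F e \<longrightarrow> (\<forall>x\<in>U. e x = 0) \<or> (\<forall>x\<in>U. e x = x)"
  show "indecomposable_form n sc U F"
    unfolding indecomposable_form_def
  proof (intro allI impI)
    fix W assume "form_direct_sum n sc U F 2 W"
    then obtain E where E: "\<And>p. p < 2 \<Longrightarrow> form_projection n sc U F (E p)"
      "\<And>p. p < 2 \<Longrightarrow> E p ` U = W p"
      "\<And>p q x. p < 2 \<Longrightarrow> q < 2 \<Longrightarrow> p \<noteq> q \<Longrightarrow> x \<in> U \<Longrightarrow> E p (E q x) = 0"
      by (rule direct_sum_projections) blast
    note im = proj_image_iff[OF E(1)]
    from * E(1)[of 0] consider "\<forall>x\<in>U. E 0 x = 0" | "\<forall>x\<in>U. E 0 x = x" by auto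
    then show "W 0 = {0} \<or> W 1 = {0}"
    proof cases
      case 1
      then have "E 0 ` U = {0}" using U_closed(1) by (auto simp: image_iff simp del: U_closed)
      then show ?thesis using E(2)[of 0] by simp
    next
      case 2
      have "E 1 x = 0" if "x \<in> U" for x
        using 2 E(3)[of 0 1 x] that sa_closed[OF proj_sa[OF E(1)[of 1]]] by simp
      then have "E 1 ` U = {0}" using U_closed(1) by (auto simp: image_iff simp del: U_closed)
      then show ?thesis using E(2)[of 1] by simp
    qed
  qed
qed

lemma proj_restrict:
  assumes e: "form_projection n sc U F e" and D: "D \<subseteq> U" "\<And>x. x \<in> D \<Longrightarrow> e x \<in> D"
  shows "form_projection n sc D F e"
proof -
  have "endo_on sc D e"
    using endo_onD(1,2)[OF sa_endo[OF proj_sa[OF e]]] subsetD[OF D(1)] D(2)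
    by (simp add: endo_on_def)
  moreover have "F (u(i := e (u i))) = F (u(j := e (u j)))"
    if "u \<in> tuples n D" "i < n" "j < n" for u i j
    using saD[OF proj_sa[OF e]] tuples_mono[OF that(1) D(1)] that(2,3) by blast
  ultimately show ?thesis
    using proj_idem[OF e] D(1) unfolding form_projection_def self_adjoint_def by blast
qed

lemma proj_id: "form_projection n sc U F (\<lambda>x. x)"
  by (simp add: form_projection_def sa_id)

lemma zero_form_zero: "zero_form n {0} F"
  unfolding zero_form_def
proof
  fix u assume u: "u \<in> tuples n {0::'a}"
  have "u \<in> tuples n U" by (rule tuples_mono[OF u]) simp
  moreover have "u(0 := 0) = u" using u n2 by (auto simp: fun_eq_iff)
  ultimately show "F u = 0" using F_zero[of u 0] n2 by simp
qed

lemma proper_subspace_dim_less: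
  assumes A: "subspace A" "A \<subset> U"
  shows "dim A < dim U"
proof -
  obtain B where B: "finite B" "U \<subseteq> span B" using finitely_spanned by blast
  obtain S where S: "S \<subseteq> A" "independent S" "A \<subseteq> span S" "card S = dim A"
    using basis_exists[of A] by metis
  obtain S' where S': "S' \<subseteq> U" "independent S'" "U \<subseteq> span S'" "card S' = dim U"
    using basis_exists[of U] by metis
  have finS': "finite S'"
    using independent_span_bound[OF B(1) S'(2) order_trans[OF S'(1) B(2)]] by simp
  obtain x where x: "x \<in> U" "x \<notin> A" using A by blast
  have "span S \<subseteq> A" using S A by (intro span_minimal) auto
  then have xS: "x \<notin> span S" using x by blast
  have ind: "independent (insert x S)" by (rule independent_insertI[OF xS S(2)])
  have "insert x S \<subseteq> span S'" using S A x S'(3) by blast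
  note bound = independent_span_bound[OF finS' ind this]
  have "x \<notin> S" using x S by blast
  moreover have "finite S" using bound by simp
  ultimately show ?thesis using bound S S' by simp
qed

end

text \<open>
  The multiset of the subspaces that carry the indecomposable summands, split off one at a time. A
  multiset rather than an indexed family, so that decompositions can be joined, reordered and matched
  without bookkeeping of indices; the space of the zero summand is left implicit.
\<close>

inductive form_decomp ::
  "nat \<Rightarrow> ('k::field \<Rightarrow> 'a::ab_group_add \<Rightarrow> 'a) \<Rightarrow> ((nat \<Rightarrow> 'a) \<Rightarrow> 'k) \<Rightarrow> 'a set \<Rightarrow> 'a set multiset \<Rightarrow> bool"
  for n sc F
where
  zero: "zero_form n U F \<Longrightarrow> form_decomp n sc F U {#}"
| add: "form_projection n sc U F e \<Longrightarrow> \<not> zero_form n (e ` U) F \<Longrightarrow>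
    indecomposable_form n sc (e ` U) F \<Longrightarrow> form_decomp n sc F {x \<in> U. e x = 0} M \<Longrightarrow>
    form_decomp n sc F U (add_mset (e ` U) M)"

lemma zero_form_mono: "zero_form n U F \<Longrightarrow> A \<subseteq> U \<Longrightarrow> zero_form n A F"
  unfolding zero_form_def using tuples_mono by blast

context form_space
begin

text \<open>
  Refining the summand \<open>e ` U\<close> by \<open>h\<close>: the summand \<open>h ` (e ` U)\<close> can be split off from \<open>U\<close> itself, and \<open>e\<close>
  still decomposes the complement \<open>U'\<close>, into the rest of \<open>e ` U\<close> and the old kernel of \<open>e\<close>.
\<close>

lemma proj_peel:
  assumes e: "form_projection n sc U F e" and h: "form_projection n sc (e ` U) F h"
  defines "U' \<equiv> {x \<in> U. h (e x) = 0}"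
  shows "form_projection n sc U F (\<lambda>x. h (e x))" "(\<lambda>x. h (e x)) ` U = h ` (e ` U)"
    "form_projection n sc U' F e" "e ` U' = {x \<in> e ` U. h x = 0}"
    "{x \<in> U'. e x = 0} = {x \<in> U. e x = 0}" "form_space sc U' n F"
proof -
  interpret eU: form_space sc "e ` U" n F by (rule proj_image_space[OF e])
  note im = proj_image_iff[OF e]
  have hmem: "h y \<in> e ` U" if "y \<in> e ` U" for y
    using eU.sa_closed[OF eU.proj_sa[OF h] that] .
  show 1: "form_projection n sc U F (\<lambda>x. h (e x))"
    unfolding form_projection_def
  proof (intro conjI ballI)
    fix x assume "x \<in> U"
    then have "e x \<in> e ` U" by simp
    then show "h (e (h (e x))) = h (e x)" using hmem im eU.proj_idem[OF h] by simp
  qed (rule proj_extend_sa[OF e eU.proj_sa[OF h]])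
  show "(\<lambda>x. h (e x)) ` U = h ` (e ` U)" by auto
  show "form_projection n sc U' F e"
    by (rule proj_restrict[OF e]) (use im proj_idem[OF e] in \<open>auto simp: U'_def\<close>)
  show "e ` U' = {x \<in> e ` U. h x = 0}"
    using proj_idem[OF e] sa_closed[OF proj_sa[OF e]] by (force simp: U'_def)
  show "{x \<in> U'. e x = 0} = {x \<in> U. e x = 0}"
    using eU.sa_zero[OF eU.proj_sa[OF h]] by (auto simp: U'_def)
  show "form_space sc U' n F"
    unfolding U'_def by (rule proj_kernel_space[OF 1])
qed

lemma zero_form_union:
  assumes e: "form_projection n sc U F e" and z: "zero_form n (e ` U) F"
    "zero_form n {x \<in> U. e x = 0} F"
  shows "zero_form n U F"
  unfolding zero_form_def
proof
  fix u assume u: "u \<in> tuples n U"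
  have "tmap n e u \<in> tuples n (e ` U)" using u by (auto intro: tmap_tuples)
  moreover have "tmap n (\<lambda>x. x - e x) u \<in> tuples n {x \<in> U. e x = 0}"
    unfolding proj_complement_image[OF e, symmetric] using u by (auto intro: tmap_tuples)
  ultimately show "F u = 0" using proj_expand[OF e u] z by (simp add: zero_form_def)
qed

end

text \<open>
  Peels off the members of \<open>K\<close> until only a zero form is left beside \<open>B\<close>. The premise treats what remains
  and is used in two ways: with a zero form on \<open>B\<close> and \<open>L = {#}\<close>, and then with an arbitrary
  decomposition \<open>L\<close> of \<open>B\<close>.
\<close>

lemma form_decomp_extend:
  assumes base: "\<And>U e. form_space sc U n F \<Longrightarrow> form_projection n sc U F e \<Longrightarrow>
      zero_form n (e ` U) F \<Longrightarrow> {x \<in> U. e x = 0} = B \<Longrightarrow> form_decomp n sc F U L"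
  shows "form_decomp n sc F A K \<Longrightarrow> form_space sc U n F \<Longrightarrow> form_projection n sc U F e \<Longrightarrow>
      e ` U = A \<Longrightarrow> {x \<in> U. e x = 0} = B \<Longrightarrow> form_decomp n sc F U (K + L)"
proof (induction A K arbitrary: U e rule: form_decomp.induct)
  case (zero A)
  then show ?case using base by simp
next
  case (add A h M)
  interpret form_space sc U n F by fact
  have h: "form_projection n sc (e ` U) F h" using add by simp
  note peel = proj_peel[OF add.prems(2) h]
  have "form_decomp n sc F {x \<in> U. h (e x) = 0} (M + L)"
    by (rule add.IH[OF peel(6) peel(3)]) (use peel(4,5) add.prems in auto)
  then have "form_decomp n sc F U (add_mset ((\<lambda>x. h (e x)) ` U) (M + L))"
    by (intro form_decomp.add[OF peel(1)]) (use add peel(2) in auto)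
  then show ?case using peel(2) add.prems by simp
qed

lemma form_decomp_union:
  assumes U: "form_space sc U n F" and e: "form_projection n sc U F e"
    and K: "form_decomp n sc F (e ` U) K" and L: "form_decomp n sc F {x \<in> U. e x = 0} L"
  shows "form_decomp n sc F U (K + L)"
proof (rule form_decomp_extend[OF _ K U e refl refl])
  fix D h assume D: "form_space sc D n F" and h: "form_projection n sc D F h"
    and z: "zero_form n (h ` D) F" and ker: "{x \<in> D. h x = 0} = {x \<in> U. e x = 0}"
  interpret D: form_space sc D n F by fact
  note c = D.proj_complement[OF h] D.proj_complement_image[OF h]
  have im: "{x \<in> D. x - h x = 0} = h ` D"
    unfolding set_eq_iff D.proj_image_iff[OF h] by fastforce
  have base: "form_decomp n sc F D' {#}"
    if "form_space sc D' n F" "form_projection n sc D' F h'" "zero_form n (h' ` D') F"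
      "{x \<in> D'. h' x = 0} = h ` D" for D' h'
    by (rule form_decomp.zero, rule form_space.zero_form_union[OF that(1-3)])
      (simp only: that(4) z)
  have "form_decomp n sc F D (L + {#})"
    by (rule form_decomp_extend[OF base L D c(1) _ im]) (simp_all only: c(2) ker)
  then show "form_decomp n sc F D L" by simp
qed

text \<open>
  By induction on the dimension: a decomposable form has two summands on proper subspaces.
\<close>

lemma form_decomp_exists:
  assumes "form_space sc U n F"
  shows "\<exists>M. form_decomp n sc F U M"
  using assms
proof (induction "vector_space.dim sc U" arbitrary: U rule: less_induct)
  case less
  interpret form_space sc U n F by fact
  consider "zero_form n U F" | "\<not> zero_form n U F" "indecomposable_form n sc U F"
    | "\<not> indecomposable_form n sc U F" by blast
  then show ?case
  proof cases
    case 1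
    then show ?thesis using form_decomp.zero by blast
  next
    case 2
    have "{x \<in> U. x = 0} = {0}" by auto
    then have "form_decomp n sc F U (add_mset ((\<lambda>x. x) ` U) {#})"
      using 2 zero_form_zero by (intro form_decomp.add[OF proj_id] form_decomp.zero) auto
    then show ?thesis by blast
  next
    case 3
    then obtain e where e: "form_projection n sc U F e" "\<not> (\<forall>x\<in>U. e x = 0)" "\<not> (\<forall>x\<in>U. e x = x)"
      using indecomposable_iff by blast
    interpret eU: form_space sc "e ` U" n F by (rule proj_image_space[OF e(1)])
    interpret kU: form_space sc "{x \<in> U. e x = 0}" n F by (rule proj_kernel_space[OF e(1)])
    have "e ` U \<subset> U" using proj_image_iff[OF e(1)] e(3) by blast
    then obtain K where K: "form_decomp n sc F (e ` U) K"
      using less.hyps proper_subspace_dim_less eU.subspace_U eU.form_space_axioms by blast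
    have "{x \<in> U. e x = 0} \<subset> U" using e(2) by blast
    then obtain L where "form_decomp n sc F {x \<in> U. e x = 0} L"
      using less.hyps proper_subspace_dim_less kU.subspace_U kU.form_space_axioms by blast
    then show ?thesis using form_decomp_union[OF less.prems e(1) K] by blast
  qed
qed

text \<open>
  By induction on a set \<open>I\<close> of indices, for the sum \<open>V I\<close> of the zero summand and the summands with index
  in \<open>I\<close>.
\<close>

lemma indecomposable_decomposition_imp_form_decomp:
  assumes "form_space sc U n F" and W: "indecomposable_decomposition n sc U F s W"
  shows "form_decomp n sc F U (image_mset W (mset_set {..<s}))"
proof -
  interpret form_space sc U n F by fact
  have ds: "form_direct_sum n sc U F (Suc s) W" and zero: "zero_form n (W s) F"
    and ind: "\<And>i. i < s \<Longrightarrow> \<not> zero_form n (W i) F \<and> indecomposable_form n sc (W i) F"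
    using W by (auto simp: indecomposable_decomposition_def)
  obtain E where E: "\<And>p. p < Suc s \<Longrightarrow> form_projection n sc U F (E p)"
    "\<And>p. p < Suc s \<Longrightarrow> E p ` U = W p"
    "\<And>x. x \<in> U \<Longrightarrow> (\<Sum>p<Suc s. E p x) = x"
    "\<And>p q x. p < Suc s \<Longrightarrow> q < Suc s \<Longrightarrow> p \<noteq> q \<Longrightarrow> x \<in> U \<Longrightarrow> E p (E q x) = 0"
    using direct_sum_projections[OF ds] by metis
  define V where "V I = {x \<in> U. \<forall>p<s. p \<notin> I \<longrightarrow> E p x = 0}" for I
  have "form_decomp n sc F (V I) (image_mset W (mset_set I))" if "finite I" "I \<subseteq> {..<s}" for I
    using that
  proof (induction I)
    case empty
    have "V {} \<subseteq> W s"
    proof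
      fix x assume x: "x \<in> V {}"
      then have "E s x = (\<Sum>p<Suc s. E p x)" by (simp add: V_def)
      also have "\<dots> = x" using x by (intro E(3)) (simp add: V_def)
      finally have "E s x = x" .
      then show "x \<in> W s" using E(2)[of s] x by (force simp: V_def)
    qed
    with zero have "zero_form n (V {}) F" using zero_form_mono by blast
    then show ?case by (simp add: form_decomp.zero)
  next
    case (insert i I)
    then have i: "i < s" "i < Suc s" by auto
    have EV: "E i x \<in> V (insert i I)" if "x \<in> U" for x
      using E(4)[OF _ i(2) _ that] sa_closed[OF proj_sa[OF E(1)[OF i(2)]] that]
      by (simp add: V_def)
    have VU: "V (insert i I) \<subseteq> U" by (auto simp: V_def)
    have im: "E i ` U = E i ` V (insert i I)"
    proof (intro equalityI subsetI)
      fix y assume "y \<in> E i ` U"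
      then have "y \<in> U" "E i y = y" using proj_image_iff[OF E(1)[OF i(2)]] by auto
      then show "y \<in> E i ` V (insert i I)" using EV by (metis imageI)
    qed (use VU in blast)
    have "form_projection n sc (V (insert i I)) F (E i)"
      using EV VU by (intro proj_restrict[OF E(1)[OF i(2)]]) auto
    moreover have "{x \<in> V (insert i I). E i x = 0} = V I"
      using insert.hyps i by (auto simp: V_def)
    ultimately have "form_decomp n sc F (V (insert i I))
        (add_mset (E i ` V (insert i I)) (image_mset W (mset_set I)))"
      using insert ind[OF i(1)] im E(2)[OF i(2)] by (intro form_decomp.add) auto
    then show ?case using insert.hyps im E(2)[OF i(2)] by simp
  qed
  from this[of "{..<s}"] have "form_decomp n sc F (V {..<s}) (image_mset W (mset_set {..<s}))"
    by simp
  moreover have "V {..<s} = U" by (auto simp: V_def)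
  ultimately show ?thesis by simp
qed

section \<open>Transport along isomorphisms up to a scalar\<close>

text \<open>
  The scalar \<open>c\<close> is \<open>1\<close> for a congruence of \<open>F\<close> with \<open>G\<close> and \<open>- 1\<close> for a congruence of \<open>F\<close> with \<open>- G\<close>.
\<close>

definition form_iso ::
  "'k \<Rightarrow> nat \<Rightarrow> ('k::field \<Rightarrow> 'a::ab_group_add \<Rightarrow> 'a) \<Rightarrow> 'a set \<Rightarrow> ((nat \<Rightarrow> 'a) \<Rightarrow> 'k) \<Rightarrow>
   ('k \<Rightarrow> 'b::ab_group_add \<Rightarrow> 'b) \<Rightarrow> 'b set \<Rightarrow> ((nat \<Rightarrow> 'b) \<Rightarrow> 'k) \<Rightarrow> ('a \<Rightarrow> 'b) \<Rightarrow> bool"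
where
  "form_iso c n sc A F sc' B G \<theta> \<longleftrightarrow>
     linear_bij sc A sc' B \<theta> \<and> (\<forall>u\<in>tuples n A. F u = c * G (tmap n \<theta> u))"

lemma linear_bijD:
  assumes "linear_bij sc A sc' B \<theta>"
  shows "x \<in> A \<Longrightarrow> y \<in> A \<Longrightarrow> \<theta> (x + y) = \<theta> x + \<theta> y"
    and "x \<in> A \<Longrightarrow> \<theta> (sc c x) = sc' c (\<theta> x)"
    and "bij_betw \<theta> A B" and "x \<in> A \<Longrightarrow> \<theta> x \<in> B"
  using assms by (auto simp: linear_bij_def linear_on_def bij_betw_apply)

lemma linear_bij_inv:
  assumes A: "fd_space sc A" and l: "linear_bij sc A sc' B \<theta>"
  shows "linear_bij sc' B sc A (inv_into A \<theta>)"
proof -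
  interpret fd_space sc A by fact
  note L = linear_bijD[OF l]
  have inv: "inv_into A \<theta> y \<in> A" "\<theta> (inv_into A \<theta> y) = y" if "y \<in> B" for y
    using L(3) that by (metis bij_betw_def inv_into_into, metis bij_betw_inv_into_right)
  have eq: "inv_into A \<theta> y = x" if "x \<in> A" "\<theta> x = y" for x y
    using L(3) that by (metis bij_betw_inv_into_left)
  show ?thesis
    unfolding linear_bij_def linear_on_def
    using inv L(1,2) bij_betw_inv_into[OF L(3)] by (auto intro!: eq)
qed

lemma linear_bij_comp:
  assumes "linear_bij sc A sc' B \<theta>" "linear_bij sc' B sc'' C \<eta>"
  shows "linear_bij sc A sc'' C (\<lambda>x. \<eta> (\<theta> x))"
  using linear_bijD[OF assms(1)] linear_bijD[OF assms(2)]
    bij_betw_trans[OF linear_bijD(3)[OF assms(1)] linear_bijD(3)[OF assms(2)]]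
  by (simp add: linear_bij_def linear_on_def o_def)

lemma linear_bij_restrict:
  assumes "linear_bij sc A sc' B \<theta>" "A' \<subseteq> A"
  shows "linear_bij sc A' sc' (\<theta> ` A') \<theta>"
  using linear_bijD[OF assms(1)] subsetD[OF assms(2)]
    bij_betw_subset[OF linear_bijD(3)[OF assms(1)] assms(2) refl]
  by (simp add: linear_bij_def linear_on_def)

lemma form_iso_linear: "form_iso c n sc A F sc' B G \<theta> \<Longrightarrow> linear_bij sc A sc' B \<theta>"
  by (simp add: form_iso_def)

lemma form_isoD: "form_iso c n sc A F sc' B G \<theta> \<Longrightarrow> u \<in> tuples n A \<Longrightarrow> F u = c * G (tmap n \<theta> u)"
  by (simp add: form_iso_def)

lemma form_iso_image: "form_iso c n sc A F sc' B G \<theta> \<Longrightarrow> \<theta> ` A = B"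
  by (rule bij_betw_imp_surj_on[OF linear_bijD(3)[OF form_iso_linear]])

lemma form_iso_restrict:
  assumes "form_iso c n sc A F sc' B G \<theta>" "A' \<subseteq> A"
  shows "form_iso c n sc A' F sc' (\<theta> ` A') G \<theta>"
  using linear_bij_restrict[OF form_iso_linear[OF assms(1)] assms(2)]
    form_isoD[OF assms(1)] tuples_mono[OF _ assms(2)]
  unfolding form_iso_def by blast

lemma form_iso_inv:
  assumes A: "fd_space sc A" and iso: "form_iso c n sc A F sc' B G \<theta>" and c: "c * d = 1"
  shows "form_iso d n sc' B G sc A F (inv_into A \<theta>)"
  unfolding form_iso_def
proof (intro conjI ballI)
  note lin = form_iso_linear[OF iso]
  show inv: "linear_bij sc' B sc A (inv_into A \<theta>)" by (rule linear_bij_inv[OF A lin])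
  fix u assume u: "u \<in> tuples n B"
  have v: "tmap n (inv_into A \<theta>) u \<in> tuples n A"
    by (rule tmap_tuples[OF u]) (rule linear_bijD(4)[OF inv])
  have "tmap n \<theta> (tmap n (inv_into A \<theta>) u) = u"
    unfolding tmap_tmap
    by (rule tmap_id[OF u]) (rule bij_betw_inv_into_right[OF linear_bijD(3)[OF lin]])
  then have "F (tmap n (inv_into A \<theta>) u) = c * G u"
    using form_isoD[OF iso v] by simp
  then have "d * F (tmap n (inv_into A \<theta>) u) = (c * d) * G u" by simp
  then show "G u = d * F (tmap n (inv_into A \<theta>) u)" using c by simp
qed

lemma form_iso_comp:
  assumes 1: "form_iso c n sc A F sc' B G \<theta>" and 2: "form_iso d n sc' B G sc'' C H \<eta>"
  shows "form_iso (c * d) n sc A F sc'' C H (\<lambda>x. \<eta> (\<theta> x))"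
  unfolding form_iso_def
proof (intro conjI ballI)
  show "linear_bij sc A sc'' C (\<lambda>x. \<eta> (\<theta> x))"
    by (rule linear_bij_comp[OF form_iso_linear[OF 1] form_iso_linear[OF 2]])
  fix u assume u: "u \<in> tuples n A"
  have "tmap n \<theta> u \<in> tuples n B"
    by (rule tmap_tuples[OF u]) (rule linear_bijD(4)[OF form_iso_linear[OF 1]])
  then show "F u = c * d * H (tmap n (\<lambda>x. \<eta> (\<theta> x)) u)"
    using form_isoD[OF 1 u] form_isoD[OF 2, of "tmap n \<theta> u"] unfolding tmap_tmap by simp
qed

lemma form_iso_self_adjoint:
  assumes A: "fd_space sc A" and iso: "form_iso c n sc A F sc' B G \<theta>" and c: "c \<noteq> 0"
    and T: "self_adjoint n sc A F T"
  shows "self_adjoint n sc' B G (\<lambda>y. \<theta> (T (inv_into A \<theta> y)))"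
proof -
  let ?i = "inv_into A \<theta>"
  note lin = form_iso_linear[OF iso]
  note L = linear_bijD[OF lin] and I = linear_bijD[OF linear_bij_inv[OF A lin]]
  have TE: "endo_on sc A T" using T unfolding self_adjoint_def by blast
  have iL: "?i (\<theta> x) = x" if "x \<in> A" for x by (rule bij_betw_inv_into_left[OF L(3) that])
  have endo: "endo_on sc' B (\<lambda>y. \<theta> (T (?i y)))"
    using TE L(1,2,4) I(1,2,4) by (simp add: endo_on_def)
  have slot: "F ((tmap n ?i v)(i := T ((tmap n ?i v) i))) = c * G (v(i := \<theta> (T (?i (v i)))))"
    if v: "v \<in> tuples n B" and i: "i < n" for v i
  proof -
    have iv: "tmap n ?i v \<in> tuples n A" using v I(4) by (rule tmap_tuples)
    have "T (?i (v i)) \<in> A" using TE I(4) tuples_mem[OF v i] by (simp add: endo_on_def)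
    then have "(tmap n ?i v)(i := T ((tmap n ?i v) i)) \<in> tuples n A"
      using iv i by (intro tuples_upd) auto
    from form_isoD[OF iso this] have "F ((tmap n ?i v)(i := T ((tmap n ?i v) i)))
        = c * G ((tmap n \<theta> (tmap n ?i v))(i := \<theta> (T ((tmap n ?i v) i))))"
      unfolding tmap_upd[OF i] .
    moreover have "tmap n \<theta> (tmap n ?i v) = v"
      unfolding tmap_tmap by (rule tmap_id[OF v]) (rule bij_betw_inv_into_right[OF L(3)])
    ultimately show ?thesis using i by simp
  qed
  have "G (v(i := \<theta> (T (?i (v i))))) = G (v(j := \<theta> (T (?i (v j)))))"
    if v: "v \<in> tuples n B" and ij: "i < n" "j < n" for v i j
  proof -
    have iv: "tmap n ?i v \<in> tuples n A" using v I(4) by (rule tmap_tuples)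
    have "F ((tmap n ?i v)(i := T ((tmap n ?i v) i))) = F ((tmap n ?i v)(j := T ((tmap n ?i v) j)))"
      using T iv ij unfolding self_adjoint_def by blast
    then show ?thesis unfolding slot[OF v ij(1)] slot[OF v ij(2)] using c by simp
  qed
  with endo show ?thesis unfolding self_adjoint_def by blast
qed

text \<open>
  Projections, and with them their images and kernels, are transported by conjugation; this carries whole
  decompositions over in \<open>form_decomp_iso\<close>.
\<close>

lemma form_iso_projection:
  assumes A: "fd_space sc A" and iso: "form_iso c n sc A F sc' B G \<theta>" and c: "c \<noteq> 0"
    and e: "form_projection n sc A F e"
  defines "e' \<equiv> (\<lambda>y. \<theta> (e (inv_into A \<theta> y)))"
  shows "form_projection n sc' B G e'" "e' ` B = \<theta> ` (e ` A)"
    "{y \<in> B. e' y = 0} = \<theta> ` {x \<in> A. e x = 0}"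
proof -
  interpret fd_space sc A by fact
  let ?i = "inv_into A \<theta>"
  note lin = form_iso_linear[OF iso]
  note L = linear_bijD[OF lin] and I = linear_bijD[OF linear_bij_inv[OF A lin]]
  have iL: "?i (\<theta> x) = x" if "x \<in> A" for x by (rule bij_betw_inv_into_left[OF L(3) that])
  have iR: "\<theta> (?i y) = y" if "y \<in> B" for y by (rule bij_betw_inv_into_right[OF L(3) that])
  have eA: "e x \<in> A" "e (e x) = e x" if "x \<in> A" for x
    using e that by (auto simp: form_projection_def self_adjoint_def endo_on_def)
  have z: "\<theta> x = 0 \<longleftrightarrow> x = 0" if "x \<in> A" for x
  proof -
    have "\<theta> 0 = 0" using L(1)[of 0 0] by simp
    then show ?thesis using L(3) that U_closed(1) by (metis bij_betw_inv_into_left)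
  qed
  show "form_projection n sc' B G e'"
    unfolding form_projection_def e'_def
    using form_iso_self_adjoint[OF A iso c] e I(4) eA iL by (simp add: form_projection_def)
  have B: "B = \<theta> ` A" using form_iso_image[OF iso] by simp
  have *: "e' (\<theta> x) = \<theta> (e x)" if "x \<in> A" for x using iL that by (simp add: e'_def)
  show "e' ` B = \<theta> ` (e ` A)" unfolding B using * by (simp add: image_image)
  show "{y \<in> B. e' y = 0} = \<theta> ` {x \<in> A. e x = 0}" unfolding B using * z eA by auto
qed

lemma form_iso_zero_form:
  assumes "form_iso c n sc A F sc' B G \<theta>" "zero_form n B G"
  shows "zero_form n A F"
  unfolding zero_form_def
proof
  fix u assume u: "u \<in> tuples n A"
  have "tmap n \<theta> u \<in> tuples n B"
    by (rule tmap_tuples[OF u]) (rule linear_bijD(4)[OF form_iso_linear[OF assms(1)]])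
  then show "F u = 0" using form_isoD[OF assms(1) u] assms(2) by (simp add: zero_form_def)
qed

lemma form_iso_indecomposable:
  assumes A: "form_space sc A n F" and B: "form_space sc' B n G"
    and iso: "form_iso c n sc A F sc' B G \<theta>" and c: "c \<noteq> 0"
    and ind: "indecomposable_form n sc' B G"
  shows "indecomposable_form n sc A F"
proof -
  interpret A: form_space sc A n F by fact
  interpret B: form_space sc' B n G by fact
  show ?thesis
    unfolding A.indecomposable_iff
  proof (intro allI impI)
    fix e assume e: "form_projection n sc A F e"
    note lin = form_iso_linear[OF iso]
    note L = linear_bijD[OF lin]
    have iL: "inv_into A \<theta> (\<theta> x) = x" if "x \<in> A" for x
      by (rule bij_betw_inv_into_left[OF L(3) that])
    have eA: "e x \<in> A" if "x \<in> A" for x using A.sa_closed[OF A.proj_sa[OF e] that] .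
    have "\<theta> 0 = 0" using L(1)[of 0 0] by simp
    then have inj: "x = y" if "\<theta> x = \<theta> y" "x \<in> A" "y \<in> A" for x y
      using iL that by metis
    note e' = form_iso_projection(1)[OF A.fd_space_axioms iso c e]
    have "(\<forall>y\<in>B. \<theta> (e (inv_into A \<theta> y)) = 0) \<or> (\<forall>y\<in>B. \<theta> (e (inv_into A \<theta> y)) = y)"
      using ind e' unfolding B.indecomposable_iff by blast
    then show "(\<forall>x\<in>A. e x = 0) \<or> (\<forall>x\<in>A. e x = x)"
    proof
      assume "\<forall>y\<in>B. \<theta> (e (inv_into A \<theta> y)) = 0"
      then have "\<theta> (e x) = \<theta> 0" if "x \<in> A" for x using L(4)[OF that] iL[OF that] \<open>\<theta> 0 = 0\<close> by metis
      then show ?thesis using inj eA by (metis A.U_closed(1))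
    next
      assume "\<forall>y\<in>B. \<theta> (e (inv_into A \<theta> y)) = y"
      then have "\<theta> (e x) = \<theta> x" if "x \<in> A" for x using L(4)[OF that] iL[OF that] by metis
      then show ?thesis using inj eA by metis
    qed
  qed
qed

lemma form_decomp_iso:
  assumes c: "c * d = 1"
  shows "form_decomp n sc F A K \<Longrightarrow> form_space sc A n F \<Longrightarrow> form_space sc' B n G \<Longrightarrow>
    form_iso c n sc A F sc' B G \<theta> \<Longrightarrow> form_decomp n sc' G B (image_mset ((`) \<theta>) K)"
proof (induction A K arbitrary: B rule: form_decomp.induct)
  case (zero A)
  interpret A: form_space sc A n F by fact
  show ?case
    using form_iso_zero_form[OF form_iso_inv[OF A.fd_space_axioms zero(4) c] zero(1)]
    by (simp add: form_decomp.zero)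
next
  case (add A e M)
  interpret A: form_space sc A n F by fact
  interpret B: form_space sc' B n G by fact
  have c0: "c \<noteq> 0" "d \<noteq> 0" "d * c = 1" using c by (auto simp: mult.commute)
  note e = add.hyps(1)
  note iso = add.prems(3)
  note e' = form_iso_projection[OF A.fd_space_axioms iso c0(1) e]
  interpret eA: form_space sc "e ` A" n F by (rule A.proj_image_space[OF e])
  have sub: "e ` A \<subseteq> A" using A.sa_closed[OF A.proj_sa[OF e]] by blast
  note eiso = form_iso_restrict[OF iso sub]
  have space': "form_space sc' (\<theta> ` e ` A) n G"
    using B.proj_image_space[OF e'(1)] unfolding e'(2) .
  have "form_decomp n sc' G {y \<in> B. \<theta> (e (inv_into A \<theta> y)) = 0} (image_mset ((`) \<theta>) M)"
    unfolding e'(3)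
    by (rule add.IH[OF A.proj_kernel_space[OF e] B.proj_kernel_space[OF e'(1), unfolded e'(3)]])
      (rule form_iso_restrict[OF iso], blast)
  moreover have "\<not> zero_form n (\<theta> ` e ` A) G"
    using form_iso_zero_form[OF eiso] add.hyps(2) by blast
  moreover have "indecomposable_form n sc' (\<theta> ` e ` A) G"
    by (rule form_iso_indecomposable[OF space' eA.form_space_axioms
          form_iso_inv[OF eA.fd_space_axioms eiso c] c0(2) add.hyps(3)])
  ultimately show ?case
    using form_decomp.add[OF e'(1)] unfolding e'(2) by simp
qed

section \<open>Roots of self-adjoint operators\<close>

context fd_space
begin

lemma endo_root_inj:
  assumes R: "endo_on sc U R" and k: "k > 0"
    and inj: "\<And>x. x \<in> U \<Longrightarrow> (R ^^ k) x = 0 \<Longrightarrow> x = 0"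
  shows "inj_on R U"
proof (rule endo_inj_onI[OF R])
  fix x assume x: "x \<in> U" "R x = 0"
  have "(R ^^ k) x = (R ^^ (k - 1)) (R x)"
    using k by (cases k) (simp_all add: funpow_Suc_right del: funpow.simps)
  then show "x = 0" using inj[OF x(1)] x(2) endo_zero[OF endo_compow[OF R]] by simp
qed

end

lemma self_adjoint_complex_root:
  fixes sc :: "complex \<Rightarrow> 'a::ab_group_add \<Rightarrow> 'a"
  assumes "form_space sc U n F" and T: "self_adjoint n sc U F T" and inj: "inj_on T U"
    and k: "k > 0"
  shows "\<exists>R. self_adjoint n sc U F R \<and> (\<forall>x\<in>U. (R ^^ k) x = T x)"
proof -
  interpret form_space sc U n F by fact
  note E = sa_endo[OF T]
  obtain m where m: "poly m 0 \<noteq> 0" "\<forall>x\<in>U. poly_op sc T m x = 0"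
    using annihilating_poly_nonzero_at_0[OF E inj] by blast
  obtain p where p: "m dvd p ^ k - [:0, 1:]" using complex_poly_root_of_X[OF m(1) k] by blast
  have "(poly_op sc T p ^^ k) x = T x" if x: "x \<in> U" for x
    using poly_op_dvd[OF E x p] m(2) x poly_op_diff[OF E x] poly_op_power[OF E x]
      poly_op_X[OF E] by simp
  then show ?thesis using sa_poly_op[OF T] by blast
qed

text \<open>
  Here \<open>R\<close> is a root of \<open>T\<close> where \<open>S\<close> is \<open>1\<close>, and a root of \<open>- T\<close> where \<open>S\<close> is \<open>- 1\<close>. Both \<open>R\<close> and \<open>S\<close> are
  polynomials in \<open>T\<close>, whence the commutation rules.
\<close>

lemma self_adjoint_real_root:
  fixes sc :: "real \<Rightarrow> 'a::ab_group_add \<Rightarrow> 'a"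
  assumes "form_space sc U n F" and T: "self_adjoint n sc U F T" and inj: "inj_on T U"
    and k: "k > 0"
  obtains R S where "self_adjoint n sc U F R" "self_adjoint n sc U F S" "inj_on R U"
    "\<And>x. x \<in> U \<Longrightarrow> S (S x) = x" "\<And>x. x \<in> U \<Longrightarrow> S (R x) = R (S x)"
    "\<And>x. x \<in> U \<Longrightarrow> S (T x) = T (S x)" "\<And>x. x \<in> U \<Longrightarrow> (R ^^ k) x = S (T x)"
proof -
  interpret form_space sc U n F by fact
  note E = sa_endo[OF T]
  obtain m where m: "poly m 0 \<noteq> 0" "\<forall>x\<in>U. poly_op sc T m x = 0"
    using annihilating_poly_nonzero_at_0[OF E inj] by blast
  obtain p q where pq: "m dvd q ^ 2 - 1" "m dvd p ^ k - q * [:0, 1:]"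
    using real_poly_signed_root_of_X[OF m(1) k] by blast
  let ?R = "poly_op sc T p" and ?S = "poly_op sc T q"
  have S2: "?S (?S x) = x" if x: "x \<in> U" for x
  proof -
    have "poly_op sc T (q ^ 2 - 1) x = 0" using poly_op_dvd[OF E x pq(1)] m(2) x by blast
    then show ?thesis
      unfolding power2_eq_square poly_op_diff[OF E x] poly_op_mult[OF E x] poly_op_1[OF E] by simp
  qed
  have root: "(?R ^^ k) x = ?S (T x)" if x: "x \<in> U" for x
  proof -
    have "poly_op sc T (p ^ k - q * [:0, 1:]) x = 0"
      using poly_op_dvd[OF E x pq(2)] m(2) x by blast
    then show ?thesis
      unfolding poly_op_diff[OF E x] poly_op_mult[OF E x] poly_op_power[OF E x] poly_op_X[OF E]
      by simp
  qed
  have "inj_on ?R U"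
  proof (rule endo_root_inj[OF poly_op_endo[OF E] k])
    fix x assume x: "x \<in> U" "(?R ^^ k) x = 0"
    then have "?S (?S (T x)) = ?S 0" using root[OF x(1)] by simp
    then have "T x = T 0"
      using S2 endo_onD(3)[OF E x(1)] endo_zero[OF poly_op_endo[OF E]] endo_zero[OF E] by simp
    then show "x = 0" using inj_onD[OF inj] x(1) by simp
  qed
  moreover have "?S (T x) = T (?S x)" if "x \<in> U" for x
    using poly_op_commute[OF E that, of q "[:0, 1:]"] unfolding poly_op_X[OF E] .
  ultimately show ?thesis
    using that[OF sa_poly_op[OF T] sa_poly_op[OF T]] S2 root poly_op_commute[OF E] by blast
qed

context form_space
begin

lemma endo_power_inj:
  assumes T: "endo_on sc U T" and inj: "inj_on T U" and x: "x \<in> U" "(T ^^ k) x = 0"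
  shows "x = 0"
  using x
proof (induction k)
  case (Suc k)
  then have "T ((T ^^ k) x) = T 0" using endo_zero[OF T] by simp
  then have "(T ^^ k) x = 0"
    using inj_onD[OF inj] endo_onD(3)[OF endo_compow[OF T] x(1)] by simp
  then show ?case using Suc by blast
qed simp

text \<open>
  By the Bezout identity \<open>u p\<close> is idempotent modulo \<open>p q\<close>, so \<open>u(T) p(T)\<close> is a projection of the form; it
  is trivial if the form is indecomposable.
\<close>

lemma indecomposable_coprime_annihilator:
  assumes ind: "indecomposable_form n sc U F" and T: "self_adjoint n sc U F T"
    and bezout: "u * p + v * q = 1" and ann: "\<And>x. x \<in> U \<Longrightarrow> poly_op sc T (p * q) x = 0"
  shows "(\<forall>x\<in>U. poly_op sc T p x = 0) \<or> (\<forall>x\<in>U. poly_op sc T q x = 0)"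
proof -
  note E = sa_endo[OF T]
  let ?e = "poly_op sc T (u * p)"
  have zero: "poly_op sc T f x = 0" if "p * q dvd f" "x \<in> U" for f x
    using poly_op_dvd[OF E that(2,1)] ann that(2) by blast
  have eq: "poly_op sc T f x = poly_op sc T g x" if "p * q dvd f - g" "x \<in> U" for f g x
    using zero[OF that] poly_op_diff[OF E that(2)] by simp
  have v: "v * q = 1 - u * p" using bezout by (simp add: algebra_simps)
  have "u * p * (u * p) - u * p = p * q * (- u * v)"
  proof -
    have "u * p * (u * p) - u * p = - (u * p * (1 - u * p))" by (simp add: algebra_simps)
    also have "\<dots> = - (u * p * (v * q))" unfolding v ..
    finally show ?thesis by (simp add: algebra_simps)
  qed
  then have "?e (?e x) = ?e x" if "x \<in> U" for x
    using eq[OF _ that, of "u * p * (u * p)" "u * p"] poly_op_mult[OF E that, of "u * p" "u * p"]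
    by simp
  then have "form_projection n sc U F ?e"
    using sa_poly_op[OF T] by (simp add: form_projection_def)
  with ind consider "\<forall>x\<in>U. ?e x = 0" | "\<forall>x\<in>U. ?e x = x" unfolding indecomposable_iff by blast
  then show ?thesis
  proof cases
    case 1
    have "p - p * (u * p) = p * q * v"
    proof -
      have "p - p * (u * p) = p * (1 - u * p)" by (simp add: algebra_simps)
      also have "\<dots> = p * (v * q)" unfolding v ..
      finally show ?thesis by (simp add: algebra_simps)
    qed
    then have "poly_op sc T p x = poly_op sc T (p * (u * p)) x" if "x \<in> U" for x
      using eq[OF _ that, of p "p * (u * p)"] by simp
    then show ?thesis
      using 1 poly_op_mult[OF E, of _ p "u * p"] endo_zero[OF poly_op_endo[OF E]] by simp
  next
    case 2
    have "q * (u * p) = p * q * u" by (simp add: algebra_simps)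
    then have "poly_op sc T (q * (u * p)) x = 0" if "x \<in> U" for x
      using zero[OF _ that] by simp
    then show ?thesis using 2 poly_op_mult[OF E, of _ q "u * p"] by simp
  qed
qed

text \<open>
  Fitting's lemma for forms: the annihilating polynomial is split as \<open>X\<^sup>k g\<close> with \<open>g(0) \<noteq> 0\<close>, and one of
  the two coprime factors annihilates \<open>T\<close>.
\<close>

lemma indecomposable_inj_or_nilpotent:
  assumes ind: "indecomposable_form n sc U F" and T: "self_adjoint n sc U F T"
  shows "inj_on T U \<or> (\<exists>k. \<forall>x\<in>U. (T ^^ k) x = 0)"
proof -
  note E = sa_endo[OF T]
  obtain m where m: "m \<noteq> 0" "\<forall>x\<in>U. poly_op sc T m x = 0" using annihilating_poly[OF E] by blast
  have "\<exists>k g. m = [:0, 1:] ^ k * g \<and> poly g 0 \<noteq> 0" using m(1)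
  proof (induction m)
    case (pCons a m)
    show ?case
    proof (cases "a = 0")
      case True
      with pCons obtain k g where "m = [:0, 1:] ^ k * g" "poly g 0 \<noteq> 0" by auto
      then have "pCons a m = [:0, 1:] ^ Suc k * g" using True by simp
      then show ?thesis using \<open>poly g 0 \<noteq> 0\<close> by blast
    next
      case False
      then show ?thesis by (intro exI[of _ 0] exI[of _ "pCons a m"]) simp
    qed
  qed simp
  then obtain k g where g: "m = [:0, 1:] ^ k * g" "poly g 0 \<noteq> 0" by blast
  obtain a h where ah: "g = pCons a h" by (cases g)
  have a: "a \<noteq> 0" using g(2) ah by simp
  \<comment> \<open>g = a (1 - w) with X dividing w, so 1 - w^k is a multiple of g and w^k one of X^k\<close>
  define w where "w = [:0, 1:] * smult (- inverse a) h"
  have w: "1 - w = smult (inverse a) g" using a by (simp add: w_def ah one_pCons)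
  have "g dvd 1 - w" unfolding w using a by (simp add: dvd_smult)
  also have "1 - w dvd 1 - w ^ k" using one_diff_power_eq[of w k] by simp
  finally obtain v where v: "1 - w ^ k = v * g" by (metis dvd_def mult.commute)
  have wk: "w ^ k = (smult (- inverse a) h) ^ k * [:0, 1:] ^ k"
    by (simp only: w_def power_mult_distrib mult.commute)
  then have bezout: "(smult (- inverse a) h) ^ k * [:0, 1:] ^ k + v * g = 1"
    unfolding wk[symmetric] v[symmetric] by simp
  have Xk: "poly_op sc T ([:0, 1:] ^ k) x = (T ^^ k) x" if "x \<in> U" for x
  proof -
    have "(poly_op sc T [:0, 1:] ^^ k) x = (T ^^ k) x" 
      by (induction k) (simp_all add: E endo_zero[OF E])
    then show ?thesis using poly_op_power[OF E that] by simp
  qed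
  from indecomposable_coprime_annihilator[OF ind T bezout] m(2) g(1)
  consider "\<forall>x\<in>U. poly_op sc T ([:0, 1:] ^ k) x = 0" | "\<forall>x\<in>U. poly_op sc T g x = 0" by blast
  then show ?thesis
  proof cases
    case 1
    then show ?thesis using Xk by metis
  next
    case 2
    have "inj_on T U"
    proof (rule endo_inj_onI[OF E])
      fix x assume x: "x \<in> U" "T x = 0"
      have "T (poly_op sc T h x) = poly_op sc T h (T x)"
        using poly_op_commute[OF E x(1), of "[:0, 1:]" h] unfolding poly_op_X[OF E] .
      then have "T (poly_op sc T h x) = 0" using x(2) endo_zero[OF poly_op_endo[OF E]] by simp
      moreover have "sc a x + T (poly_op sc T h x) = 0" using 2 x(1) E by (simp add: ah)
      ultimately have "sc a x = 0" by simp
      then show "x = 0" using a by simp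
    qed
    then show ?thesis by blast
  qed
qed

lemma sa_inverse:
  assumes R: "self_adjoint n sc U F R" and inj: "inj_on R U"
  shows "self_adjoint n sc U F (inv_into U R)"
proof -
  let ?r = "inv_into U R"
  note E = endo_onD[OF sa_endo[OF R]]
  note bij = endo_inj_imp_bij[OF sa_endo[OF R] inj]
  have lin: "linear_bij sc U sc U R"
    using bij E by (simp add: linear_bij_def linear_on_def)
  note L = linear_bijD[OF linear_bij_inv[OF fd_space_axioms lin]]
  have Rr: "R (?r x) = x" if "x \<in> U" for x by (rule bij_betw_inv_into_right[OF bij that])
  have "endo_on sc U ?r" using L by (simp add: endo_on_def)
  moreover have "F (u(i := ?r (u i))) = F (u(j := ?r (u j)))"
    if u: "u \<in> tuples n U" and ij: "i < n" "j < n" for u i j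
  proof (cases "i = j")
    case False
    \<comment> \<open>both arguments carry the inverse, so that applying R to either of them cancels it\<close>
    let ?w = "u(i := ?r (u i), j := ?r (u j))"
    have w: "?w \<in> tuples n U"
      using u ij by (intro tuples_upd L(4) tuples_mem[OF u])
    have "?w(i := R (?w i)) = u(j := ?r (u j))" "?w(j := R (?w j)) = u(i := ?r (u i))"
      using False Rr tuples_mem[OF u] ij by (auto simp: fun_eq_iff)
    then show ?thesis using saD[OF R w ij] by metis
  qed simp
  ultimately show ?thesis unfolding self_adjoint_def by blast
qed

text \<open>
  The constant \<open>h\<close> is \<open>1/2\<close>; the operator projects to the fixed vectors of the involution \<open>S\<close>.
\<close>

lemma sa_halves_projection:
  assumes S: "self_adjoint n sc U F S" and inv: "\<And>x. x \<in> U \<Longrightarrow> S (S x) = x"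
    and two: "h + h = (1::'k)"
  shows "form_projection n sc U F (\<lambda>x. sc h (x + S x))"
  unfolding form_projection_def
proof (intro conjI ballI)
  show "self_adjoint n sc U F (\<lambda>x. sc h (x + S x))"
    by (rule sa_scale[OF sa_add[OF sa_id S]])
  note E = endo_onD[OF sa_endo[OF S]]
  fix x assume x: "x \<in> U"
  let ?y = "sc h (x + S x)"
  have "S ?y = ?y" using x E inv by (simp add: add.commute)
  then have "sc h (?y + S ?y) = sc h (?y + ?y)" by (simp only:)
  also have "\<dots> = sc (h + h) ?y"
    by (simp only: scale_left_distrib[of h h ?y] scale_right_distrib[of h ?y ?y])
  finally have "sc h (?y + S ?y) = sc (h + h) ?y" .
  then show "sc h (?y + S ?y) = ?y" using two by simp
qed

end

text \<open>
  The eigenspaces of the involution \<open>S\<close> with \<open>R\<^sup>k = S T\<close> decompose the form, so \<open>S\<close> is the scalar \<open>1\<close> or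
  \<open>- 1\<close> if the form is indecomposable.
\<close>

lemma indecomposable_real_root:
  fixes sc :: "real \<Rightarrow> 'a::ab_group_add \<Rightarrow> 'a"
  assumes "form_space sc U n F" and ind: "indecomposable_form n sc U F"
    and T: "self_adjoint n sc U F T" and inj: "inj_on T U" and k: "k > 0"
  obtains R c where "self_adjoint n sc U F R" "inj_on R U" "c \<in> {1, - 1}"
    "\<And>x. x \<in> U \<Longrightarrow> (R ^^ k) x = sc c (T x)"
proof -
  interpret form_space sc U n F by fact
  obtain R S where RS: "self_adjoint n sc U F R" "self_adjoint n sc U F S" "inj_on R U"
    "\<And>x. x \<in> U \<Longrightarrow> S (S x) = x" "\<And>x. x \<in> U \<Longrightarrow> (R ^^ k) x = S (T x)"
    using self_adjoint_real_root[OF assms(1) T inj k] by metis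
  have "form_projection n sc U F (\<lambda>x. sc (1 / 2) (x + S x))"
    by (rule sa_halves_projection[OF RS(2) RS(4)]) simp_all
  with ind consider "\<forall>x\<in>U. sc (1 / 2) (x + S x) = 0" | "\<forall>x\<in>U. sc (1 / 2) (x + S x) = x"
    unfolding indecomposable_iff by blast
  then have "\<exists>c\<in>{1, - 1}. \<forall>x\<in>U. S x = sc c x"
  proof cases
    case 1
    then have "S x = sc (- 1) x" if "x \<in> U" for x
      using that by (simp add: add_eq_0_iff)
    then show ?thesis by blast
  next
    case 2
    have "S x = sc 1 x" if "x \<in> U" for x
    proof -
      have "sc 2 (sc (1 / 2) (x + S x)) = sc 2 x" using 2 that by simp
      moreover have "sc 2 x = x + x" using scale_left_distrib[of 1 1 x] by simp
      ultimately show ?thesis by simp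
    qed
    then show ?thesis by blast
  qed
  then obtain c where "c \<in> {1, - 1}" "\<forall>x\<in>U. S x = sc c x" by blast
  then show ?thesis using that[OF RS(1,3)] RS(5) sa_closed[OF T] by simp
qed

text \<open>
  The counterpart of the fact that non-units of a local ring are closed under addition. With
  \<open>R\<^sup>2 = c (S + T)\<close>, the operator \<open>Q = R\<^sup>-\<^sup>1 S R\<^sup>-\<^sup>1\<close> is self-adjoint, hence injective or nilpotent. In the
  first case \<open>S\<close> is injective. In the second one, \<open>T x = 0\<close> makes \<open>R x\<close> an eigenvector of \<open>Q\<close> with
  eigenvalue \<open>c = \<plusminus> 1\<close>, so that \<open>x = 0\<close>.
\<close>

lemma indecomposable_sum_inj:
  fixes sc :: "real \<Rightarrow> 'a::ab_group_add \<Rightarrow> 'a"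
  assumes "form_space sc U n F" and ind: "indecomposable_form n sc U F"
    and S: "self_adjoint n sc U F S" and T: "self_adjoint n sc U F T"
    and inj: "inj_on (\<lambda>x. S x + T x) U"
  shows "inj_on S U \<or> inj_on T U"
proof -
  interpret form_space sc U n F by fact
  obtain R c where R: "self_adjoint n sc U F R" "inj_on R U" and c: "c \<in> {1, - 1}"
    and root: "\<And>x. x \<in> U \<Longrightarrow> (R ^^ 2) x = sc c (S x + T x)"
    using indecomposable_real_root[OF assms(1) ind sa_add[OF S T] inj, of 2] by auto
  let ?r = "inv_into U R"
  note r = sa_inverse[OF R]
  have rR: "?r (R x) = x" if "x \<in> U" for x using R(2) that by simp
  define Q where "Q = (\<lambda>x. ?r (S (?r x)))"
  have Q: "self_adjoint n sc U F Q" unfolding Q_def by (rule sa_sandwich[OF r S])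
  from indecomposable_inj_or_nilpotent[OF ind Q] show ?thesis
  proof
    assume Qinj: "inj_on Q U"
    have "inj_on S U"
    proof (rule endo_inj_onI[OF sa_endo[OF S]])
      fix x assume x: "x \<in> U" "S x = 0"
      then have "Q (R x) = Q 0" using rR sa_zero[OF r] sa_zero[OF S] by (simp add: Q_def)
      then have "R x = R 0" using inj_onD[OF Qinj] sa_closed[OF R(1)] x sa_zero[OF R(1)] by simp
      then show "x = 0" using inj_onD[OF R(2)] x by simp
    qed
    then show ?thesis ..
  next
    assume "\<exists>k. \<forall>x\<in>U. (Q ^^ k) x = 0"
    then obtain k where k: "\<forall>x\<in>U. (Q ^^ k) x = 0" by blast
    have "inj_on T U"
    proof (rule endo_inj_onI[OF sa_endo[OF T]])
      fix x assume x: "x \<in> U" "T x = 0"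
      have Rx: "R x \<in> U" using sa_closed[OF R(1) x(1)] .
      have "R (R x) = sc c (S x)" using root[OF x(1)] x(2) by (simp add: numeral_2_eq_2)
      then have "sc c (R (R x)) = S x" using c by auto
      then have "Q (R x) = ?r (sc c (R (R x)))" using rR[OF x(1)] by (simp add: Q_def)
      also have "\<dots> = sc c (R x)"
        using endo_onD(2)[OF sa_endo[OF r] sa_closed[OF R(1) Rx]] rR[OF Rx] by simp
      finally have QR: "Q (R x) = sc c (R x)" .
      have "(Q ^^ j) (R x) = sc (c ^ j) (R x)" for j
        by (induction j) (use QR Rx endo_onD(2)[OF sa_endo[OF Q]] in \<open>simp_all add: mult.commute\<close>)
      then have "sc (c ^ k) (R x) = 0" using k Rx by metis
      then have "R x = R 0" using c sa_zero[OF R(1)] by auto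
      then show "x = 0" using inj_onD[OF R(2)] x by simp
    qed
    then show ?thesis ..
  qed
qed

section \<open>Exchange of indecomposable summands\<close>

context form_space
begin

lemma proj_nonzero_imp:
  "\<not> zero_form n A F \<Longrightarrow> A \<noteq> {0}"
  using zero_form_zero by blast

text \<open>
  The pullback of the form along \<open>h\<close>, restricted to the image of \<open>e\<close>, is the form on that image twisted by
  the compression \<open>e h\<close>.
\<close>

lemma tmap_compress:
  assumes e: "form_projection n sc U F e" and h: "form_projection n sc U F h"
    and u: "u \<in> tuples n (e ` U)"
  shows "F (tmap n h u) = F (u(0 := e (h (u 0))))"
proof -
  have 0: "0 < n" using n2 by simp
  have "e ` U \<subseteq> U" using sa_closed[OF proj_sa[OF e]] by blast
  then have uU: "u \<in> tuples n U" using u tuples_mono by blast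
  have "h (u 0) \<in> U" by (rule sa_closed[OF proj_sa[OF h] tuples_mem[OF uU 0]])
  from proj_compress_slot[OF e u 0 this] proj_distribute[OF h uU 0] show ?thesis by (simp only:)
qed

lemma projections_linear_bij:
  assumes e: "form_projection n sc U F e" and h: "form_projection n sc U F h"
    and inj_e: "inj_on (\<lambda>x. e (h x)) (e ` U)" and inj_h: "inj_on (\<lambda>x. h (e x)) (h ` U)"
  shows "linear_bij sc (e ` U) sc (h ` U) h"
proof -
  interpret hU: form_space sc "h ` U" n F by (rule proj_image_space[OF h])
  have eU: "e ` U \<subseteq> U" "h ` U \<subseteq> U"
    using sa_closed[OF proj_sa[OF e]] sa_closed[OF proj_sa[OF h]] by auto
  have "bij_betw (\<lambda>x. h (e x)) (h ` U) (h ` U)"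
    by (rule hU.endo_inj_imp_bij[OF hU.sa_endo[OF proj_compress_sa[OF h proj_sa[OF e]]] inj_h])
  then have "h ` U = (\<lambda>x. h (e x)) ` (h ` U)" by (simp add: bij_betw_def)
  then have "h ` U \<subseteq> h ` (e ` U)" using eU(2) by blast
  then have "h ` (e ` U) = h ` U" using eU(1) by blast
  moreover have "inj_on h (e ` U)" using inj_e by (metis (no_types, lifting) inj_on_def)
  ultimately show ?thesis
    using endo_onD[OF sa_endo[OF proj_sa[OF h]]] subsetD[OF eU(1)]
    by (simp add: linear_bij_def linear_on_def bij_betw_def)
qed

text \<open>
  Cancellation: if \<open>e h\<close> and \<open>h e\<close> are injective on the images of \<open>e\<close> and \<open>h\<close>, a vector in the kernel of
  \<open>(1 - e) (1 - h)\<close> on the complement yields first a vector in the kernel of \<open>e h\<close> and then one in that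
  of \<open>h e\<close>.
\<close>

lemma complement_compress_inj:
  assumes e: "form_projection n sc U F e" and h: "form_projection n sc U F h"
    and inj_e: "inj_on (\<lambda>x. e (h x)) (e ` U)" and inj_h: "inj_on (\<lambda>x. h (e x)) (h ` U)"
  defines "e' \<equiv> (\<lambda>x. x - e x)" and "h' \<equiv> (\<lambda>x. x - h x)"
  shows "inj_on (\<lambda>x. e' (h' x)) (e' ` U)"
proof -
  have e': "form_projection n sc U F e'" and h': "form_projection n sc U F h'"
    unfolding e'_def h'_def by (rule proj_complement[OF e], rule proj_complement[OF h])
  interpret e'U: form_space sc "e' ` U" n F by (rule proj_image_space[OF e'])
  have h0: "h 0 = 0" and e0: "e 0 = 0"
    using sa_zero[OF proj_sa[OF h]] sa_zero[OF proj_sa[OF e]] by auto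
  show ?thesis
  proof (rule e'U.endo_inj_onI[OF e'U.sa_endo[OF proj_compress_sa[OF e' proj_sa[OF h']]]])
    fix x assume x: "x \<in> e' ` U" "e' (h' x) = 0"
    then have xU: "x \<in> U" "e x = 0"
      using proj_complement_image[OF e] unfolding e'_def by auto
    define z where "z = h' x"
    have zU: "z \<in> U" "h z = 0"
      using proj_complement_image[OF h] xU(1) unfolding z_def h'_def by auto
    have "e z = z" using x(2) by (simp add: z_def e'_def)
    then have "z \<in> e ` U" "0 \<in> e ` U" using zU(1) e0 U_closed(1) by (metis imageI)+
    moreover have "e (h z) = e (h 0)" using zU(2) h0 by simp
    ultimately have "z = 0" using inj_onD[OF inj_e] by blast
    then have "h x = x" by (simp add: z_def h'_def)
    then have "x \<in> h ` U" "0 \<in> h ` U" using xU(1) h0 U_closed(1) by (metis imageI)+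
    moreover have "h (e x) = h (e 0)" using xU(2) e0 by simp
    ultimately show "x = 0" using inj_onD[OF inj_h] by blast
  qed
qed

text \<open>
  Since \<open>h (e h)\<^sup>k = (h e)\<^sup>k h\<close>, nilpotency of \<open>h e\<close> would carry over to the injective operator \<open>e h\<close>.
\<close>

lemma opposite_compress_inj:
  assumes e: "form_projection n sc U F e" and h: "form_projection n sc U F h"
    and inj: "inj_on (\<lambda>x. e (h x)) (e ` U)" and nz: "e ` U \<noteq> {0}"
    and ind: "indecomposable_form n sc (h ` U) F"
  shows "inj_on (\<lambda>x. h (e x)) (h ` U)"
proof -
  interpret eU: form_space sc "e ` U" n F by (rule proj_image_space[OF e])
  interpret hU: form_space sc "h ` U" n F by (rule proj_image_space[OF h])
  let ?P = "\<lambda>x. e (h x)" and ?Q = "\<lambda>x. h (e x)"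
  have P: "self_adjoint n sc (e ` U) F ?P" by (rule proj_compress_sa[OF e proj_sa[OF h]])
  have Q: "self_adjoint n sc (h ` U) F ?Q" by (rule proj_compress_sa[OF h proj_sa[OF e]])
  have "\<nexists>k. \<forall>x\<in>h ` U. (?Q ^^ k) x = 0"
  proof
    assume "\<exists>k. \<forall>x\<in>h ` U. (?Q ^^ k) x = 0"
    then obtain k where k: "\<forall>x\<in>h ` U. (?Q ^^ k) x = 0" by blast
    have intertwine: "h ((?P ^^ j) x) = (?Q ^^ j) (h x)" for j x by (induction j) simp_all
    have "x = 0" if x: "x \<in> e ` U" for x
    proof (rule eU.endo_power_inj[OF eU.sa_endo[OF P] inj x, of "Suc k"])
      have "h x \<in> h ` U" using x proj_image_iff[OF e] by blast
      then have "h ((?P ^^ k) x) = 0" using k unfolding intertwine by blast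
      then show "(?P ^^ Suc k) x = 0" using sa_zero[OF proj_sa[OF e]] by simp
    qed
    then show False using nz eU.U_closed(1) by blast
  qed
  then show ?thesis using hU.indecomposable_inj_or_nilpotent[OF ind Q] by blast
qed

end

text \<open>
  The projection \<open>g\<close> to \<open>D\<close> is the sum of the projections to the summands in \<open>N\<close> and to the zero summand,
  so some member of \<open>N\<close> inherits the injectivity of \<open>e g\<close> on the indecomposable summand \<open>e ` U\<close>. The zero
  summand cannot inherit it, as the form on \<open>e ` U\<close> would vanish. The recursion over \<open>N\<close> splits \<open>g\<close> into
  two projections at a time.
\<close>

lemma exchange_projection:
  fixes sc :: "real \<Rightarrow> 'a::ab_group_add \<Rightarrow> 'a"
  assumes U: "form_space sc U n F" and e: "form_projection n sc U F e"
    and ind: "indecomposable_form n sc (e ` U) F" and nz: "\<not> zero_form n (e ` U) F"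
  shows "form_decomp n sc F D N \<Longrightarrow> form_projection n sc U F g \<Longrightarrow> g ` U = D \<Longrightarrow>
    inj_on (\<lambda>x. e (g x)) (e ` U) \<Longrightarrow>
    \<exists>h. h ` D \<in># N \<and> form_projection n sc D F h \<and> indecomposable_form n sc (h ` D) F \<and>
      form_decomp n sc F {x \<in> D. h x = 0} (N - {#h ` D#}) \<and>
      inj_on (\<lambda>x. e (h (g x))) (e ` U)"
proof (induction D N arbitrary: g rule: form_decomp.induct)
  case (zero D)
  interpret form_space sc U n F by fact
  interpret eU: form_space sc "e ` U" n F by (rule proj_image_space[OF e])
  note g = zero(2)
  have T: "self_adjoint n sc (e ` U) F (\<lambda>x. e (g x))" by (rule proj_compress_sa[OF e proj_sa[OF g]])
  have bij: "bij_betw (\<lambda>x. e (g x)) (e ` U) (e ` U)"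
    by (rule eU.endo_inj_imp_bij[OF eU.sa_endo[OF T] zero(4)])
  have 0: "0 < n" using n2 by simp
  have "zero_form n (e ` U) F"
    unfolding zero_form_def
  proof
    fix u assume u: "u \<in> tuples n (e ` U)"
    have "u 0 \<in> (\<lambda>x. e (g x)) ` (e ` U)"
      using bij tuples_mem[OF u 0] unfolding bij_betw_def by blast
    then obtain y where y: "u 0 = e (g y)" "y \<in> e ` U" by (rule imageE)
    let ?v = "u(0 := y)"
    have v: "?v \<in> tuples n (e ` U)" by (rule tuples_upd[OF u 0 y(2)])
    have eU: "e ` U \<subseteq> U" using sa_closed[OF proj_sa[OF e]] by blast
    have "tmap n g ?v \<in> tuples n D"
      by (rule tmap_tuples[OF tuples_mono[OF v eU]]) (use zero(3) in blast)
    then have "F (tmap n g ?v) = 0" using zero(1) by (simp only: zero_form_def)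
    moreover have "?v(0 := e (g (?v 0))) = u" using y(1)[symmetric] by simp
    ultimately show "F u = 0" using tmap_compress[OF e g v] by metis
  qed
  then show ?case using nz by blast
next
  case (add D a M)
  interpret form_space sc U n F by fact
  interpret eU: form_space sc "e ` U" n F by (rule proj_image_space[OF e])
  note g = add.prems(1) and gU = add.prems(2) and a = add.hyps(1)
  interpret D: form_space sc D n F using proj_image_space[OF g] unfolding gU .
  let ?b = "\<lambda>x. x - a x"
  have b: "form_projection n sc D F ?b" by (rule D.proj_complement[OF a])
  have b_im: "?b ` D = {x \<in> D. a x = 0}" by (rule D.proj_complement_image[OF a])
  note ag = proj_peel(1)[OF g, unfolded gU, OF a]
  note bg = proj_peel(1,2)[OF g, unfolded gU, OF b]
  have S: "self_adjoint n sc (e ` U) F (\<lambda>x. e (a (g x)))"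
    by (rule proj_compress_sa[OF e proj_sa[OF ag]])
  have T: "self_adjoint n sc (e ` U) F (\<lambda>x. e (?b (g x)))"
    by (rule proj_compress_sa[OF e proj_sa[OF bg(1)]])
  have "e (a (g x)) + e (?b (g x)) = e (g x)" if "x \<in> e ` U" for x
  proof -
    have "x \<in> U" using that sa_closed[OF proj_sa[OF e]] by blast
    then show ?thesis
      using endo_onD(1)[OF sa_endo[OF proj_sa[OF e]], of "a (g x)" "?b (g x)"]
        sa_closed[OF proj_sa[OF ag]] sa_closed[OF proj_sa[OF bg(1)]] by simp
  qed
  then have "inj_on (\<lambda>x. e (a (g x)) + e (?b (g x))) (e ` U)"
    using add.prems(3) by (simp cong: inj_on_cong)
  from indecomposable_sum_inj[OF eU.form_space_axioms ind S T this] show ?case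
  proof
    assume "inj_on (\<lambda>x. e (a (g x))) (e ` U)"
    then show ?thesis using a add.hyps(3,4) by (intro exI[of _ a]) simp
  next
    assume inj_b: "inj_on (\<lambda>x. e (?b (g x))) (e ` U)"
    have "(\<lambda>x. ?b (g x)) ` U = {x \<in> D. a x = 0}" using bg(2) b_im by simp
    from add.IH[OF bg(1) this inj_b] obtain h where
      h: "h ` {x \<in> D. a x = 0} \<in># M" "form_projection n sc {x \<in> D. a x = 0} F h"
        "indecomposable_form n sc (h ` {x \<in> D. a x = 0}) F"
        "form_decomp n sc F {x \<in> {x \<in> D. a x = 0}. h x = 0} (M - {#h ` {x \<in> D. a x = 0}#})"
        "inj_on (\<lambda>x. e (h (?b (g x)))) (e ` U)"
      by blast
    let ?h = "\<lambda>x. h (?b x)" and ?B = "h ` {x \<in> D. a x = 0}"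
    let ?K = "{x \<in> D. ?h x = 0}"
    note peel = D.proj_peel[OF b, unfolded b_im, OF h(2)]
    interpret ker: form_space sc "{x \<in> D. a x = 0}" n F by (rule D.proj_kernel_space[OF a])
    have h0: "h 0 = 0" by (rule ker.sa_zero[OF ker.proj_sa[OF h(2)]])
    have a0: "a 0 = 0" by (rule D.sa_zero[OF D.proj_sa[OF a]])
    \<comment> \<open>the summand found in the kernel of a is split off first; the image of a lies in its complement\<close>
    have aK: "a x \<in> ?K" if "x \<in> D" for x
      using that h0 D.proj_idem[OF a] D.sa_closed[OF D.proj_sa[OF a]] by simp
    have proj: "form_projection n sc ?K F a"
      using aK by (intro D.proj_restrict[OF a]) auto
    have im: "a ` ?K = a ` D"
    proof (intro equalityI subsetI)
      fix y assume "y \<in> a ` D"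
      then have "y \<in> D" "a y = y" using D.proj_image_iff[OF a] by auto
      then show "y \<in> a ` ?K" using aK by (metis imageI)
    qed blast
    have kerK: "{x \<in> ?K. a x = 0} = {x \<in> {x \<in> D. a x = 0}. h x = 0}" by auto
    have "form_decomp n sc F ?K (add_mset (a ` ?K) (M - {#?B#}))"
      by (rule form_decomp.add[OF proj]) (use add.hyps(2,3) h(4) in \<open>simp_all only: im kerK not_False_eq_True\<close>)
    moreover have "add_mset (a ` ?K) (M - {#?B#}) = add_mset (a ` D) M - {#?B#}"
      using h(1) unfolding im by (cases "a ` D = ?B") auto
    moreover have hD: "?h ` D = ?B" using peel(2) .
    ultimately show ?thesis
      using h(1,3,5) peel(1) by (intro exI[of _ ?h]) (simp only: hD, simp)
  qed
qed

definition sign_congruent ::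
  "nat \<Rightarrow> (real \<Rightarrow> 'a::ab_group_add \<Rightarrow> 'a) \<Rightarrow> ((nat \<Rightarrow> 'a) \<Rightarrow> real) \<Rightarrow>
   (real \<Rightarrow> 'b::ab_group_add \<Rightarrow> 'b) \<Rightarrow> ((nat \<Rightarrow> 'b) \<Rightarrow> real) \<Rightarrow> 'a set \<Rightarrow> 'b set \<Rightarrow> bool"
where
  "sign_congruent n sc F sc' G A B \<longleftrightarrow> (\<exists>c\<in>{1, - 1}. \<exists>\<theta>. form_iso c n sc A F sc' B G \<theta>)"

lemma sign_congruent_trans:
  assumes "sign_congruent n sc F sc' G A B" "sign_congruent n sc' G sc'' H B C"
  shows "sign_congruent n sc F sc'' H A C"
proof -
  obtain c \<theta> d \<eta> where *: "c \<in> {1, - 1}" "d \<in> {1, - 1}" "form_iso c n sc A F sc' B G \<theta>"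
    "form_iso d n sc' B G sc'' C H \<eta>"
    using assms unfolding sign_congruent_def by blast
  then show ?thesis
    using form_iso_comp[OF *(3,4)] unfolding sign_congruent_def by (intro bexI[of _ "c * d"]) auto
qed

lemma rel_mset_sign_congruent_trans:
  assumes "rel_mset (sign_congruent n sc F sc' G) K L" "rel_mset (sign_congruent n sc' G sc'' H) L M"
  shows "rel_mset (sign_congruent n sc F sc'' H) K M"
proof -
  have "(rel_mset (sign_congruent n sc F sc' G) OO rel_mset (sign_congruent n sc' G sc'' H)) K M"
    using assms by blast
  then have "rel_mset (sign_congruent n sc F sc' G OO sign_congruent n sc' G sc'' H) K M"
    by (simp add: multiset.rel_compp)
  then show ?thesis by (rule multiset.rel_mono_strong) (use sign_congruent_trans in blast)
qed

text \<open>
  The map \<open>h\<close> from \<open>e ` U\<close> to \<open>h ` U\<close> pulls the form back to its twist by \<open>e h\<close>, and a root of \<open>\<plusminus> e h\<close>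
  removes the twist.
\<close>

lemma exchange_summand:
  fixes sc :: "real \<Rightarrow> 'a::ab_group_add \<Rightarrow> 'a"
  assumes U: "form_space sc U n F" and e: "form_projection n sc U F e"
    and ind: "indecomposable_form n sc (e ` U) F" and nz: "\<not> zero_form n (e ` U) F"
    and N: "form_decomp n sc F U N"
  obtains h where "form_projection n sc U F h" "h ` U \<in># N"
    "form_decomp n sc F {x \<in> U. h x = 0} (N - {#h ` U#})"
    "sign_congruent n sc F sc F (e ` U) (h ` U)"
    "inj_on (\<lambda>x. e (h x)) (e ` U)" "inj_on (\<lambda>x. h (e x)) (h ` U)"
proof -
  interpret form_space sc U n F by fact
  interpret eU: form_space sc "e ` U" n F by (rule proj_image_space[OF e])
  have "e ` U \<subseteq> U" using sa_closed[OF proj_sa[OF e]] by blast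
  have "inj_on e (e ` U)" using proj_image_iff[OF e] by (metis inj_onI)
  then obtain h where h: "h ` U \<in># N" "form_projection n sc U F h"
    "indecomposable_form n sc (h ` U) F" "form_decomp n sc F {x \<in> U. h x = 0} (N - {#h ` U#})"
    "inj_on (\<lambda>x. e (h x)) (e ` U)"
    using exchange_projection[OF U e ind nz N proj_id] by auto
  have inj_h: "inj_on (\<lambda>x. h (e x)) (h ` U)"
    by (rule opposite_compress_inj[OF e h(2,5) proj_nonzero_imp[OF nz] h(3)])
  have T: "self_adjoint n sc (e ` U) F (\<lambda>x. e (h x))" by (rule proj_compress_sa[OF e proj_sa[OF h(2)]])
  have 0: "0 < n" using n2 by simp
  obtain R c where R: "self_adjoint n sc (e ` U) F R" "inj_on R (e ` U)" and c: "c \<in> {1, - 1}"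
    and root: "\<And>x. x \<in> e ` U \<Longrightarrow> (R ^^ n) x = sc c (e (h x))"
    using indecomposable_real_root[OF eU.form_space_axioms ind T h(5) 0] by metis
  have R_lin: "linear_bij sc (e ` U) sc (e ` U) R"
    using eU.endo_inj_imp_bij[OF eU.sa_endo[OF R(1)] R(2)] eU.endo_onD[OF eU.sa_endo[OF R(1)]]
    by (simp add: linear_bij_def linear_on_def)
  \<comment> \<open>H is the form on the image of h, pulled back to the image of e\<close>
  define H where "H u = F (tmap n h u)" for u
  have cc: "c * c = 1" using c by auto
  have H_eq: "H u = c * F (tmap n R u)" if u: "u \<in> tuples n (e ` U)" for u
  proof -
    have x: "e (h (u 0)) \<in> e ` U" using eU.sa_closed[OF T tuples_mem[OF u 0]] .
    have "F (tmap n R u) = F (u(0 := sc c (e (h (u 0)))))"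
      using eU.sa_power_distribute[OF R(1) u 0] root[OF tuples_mem[OF u 0]] by (simp only:)
    also have "\<dots> = c * H u"
      unfolding eU.F_scale[OF u 0 x] H_def tmap_compress[OF e h(2) u] ..
    finally show ?thesis using cc by simp
  qed
  have "form_iso c n sc (e ` U) H sc (e ` U) F R"
    using R_lin H_eq by (simp only: form_iso_def) blast
  from form_iso_inv[OF eU.fd_space_axioms this cc]
  have "form_iso c n sc (e ` U) F sc (e ` U) H (inv_into (e ` U) R)" .
  moreover have "form_iso 1 n sc (e ` U) H sc (h ` U) F h"
    using projections_linear_bij[OF e h(2,5) inj_h] by (simp add: form_iso_def H_def)
  ultimately have "form_iso (c * 1) n sc (e ` U) F sc (h ` U) F (\<lambda>x. h (inv_into (e ` U) R x))"
    by (rule form_iso_comp)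
  then have "sign_congruent n sc F sc F (e ` U) (h ` U)"
    unfolding sign_congruent_def using c by auto
  then show ?thesis using that h inj_h by blast
qed

section \<open>Uniqueness of decompositions over the reals\<close>

lemma form_decomp_subset:
  "form_decomp n sc F U M \<Longrightarrow> A \<in># M \<Longrightarrow> A \<subseteq> U"
proof (induction rule: form_decomp.induct)
  case (add U e M)
  have "e ` U \<subseteq> U"
    using add.hyps(1) by (auto simp: form_projection_def self_adjoint_def endo_on_def)
  then show ?case using add by auto
qed simp

text \<open>
  With \<open>R\<^sup>n = S \<psi>\<close>, replacing \<open>\<theta>\<close> by \<open>\<eta> = \<theta> R\<^sup>-\<^sup>1\<close> reduces the twist to the involution \<open>S\<close>. Then \<open>\<eta>\<close> is an
  isomorphism from \<open>G\<close> to \<open>F\<close> on the fixed space of \<open>S\<close> and to \<open>- F\<close> on its eigenspace for \<open>- 1\<close>, and any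
  decompositions of \<open>G\<close> on these two spaces can be transported.
\<close>

lemma twisted_common_decomposition:
  fixes sc :: "real \<Rightarrow> 'a::ab_group_add \<Rightarrow> 'a" and sc' :: "real \<Rightarrow> 'b::ab_group_add \<Rightarrow> 'b"
  assumes V: "form_space sc V n G" and U: "form_space sc' U n F"
    and \<theta>: "linear_bij sc V sc' U \<theta>"
    and \<psi>: "self_adjoint n sc V G \<psi>" "inj_on \<psi> V"
    and twist: "\<And>v. v \<in> tuples n V \<Longrightarrow> F (tmap n \<theta> v) = G (v(0 := \<psi> (v 0)))"
  obtains M N where "form_decomp n sc G V M" "form_decomp n sc' F U N"
    "rel_mset (sign_congruent n sc G sc' F) M N"
proof -
  interpret V: form_space sc V n G by fact
  interpret U: form_space sc' U n F by fact
  have 0: "0 < n" using V.n2 by simp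
  obtain R S where R: "self_adjoint n sc V G R" "inj_on R V" and S: "self_adjoint n sc V G S"
    "\<And>x. x \<in> V \<Longrightarrow> S (S x) = x" "\<And>x. x \<in> V \<Longrightarrow> S (R x) = R (S x)"
    "\<And>x. x \<in> V \<Longrightarrow> S (\<psi> x) = \<psi> (S x)"
    and root: "\<And>x. x \<in> V \<Longrightarrow> (R ^^ n) x = S (\<psi> x)"
    using self_adjoint_real_root[OF V \<psi> 0] by metis
  have Rbij: "bij_betw R V V" by (rule V.endo_inj_imp_bij[OF V.sa_endo[OF R(1)] R(2)])
  have R_lin: "linear_bij sc V sc V R"
    using Rbij V.endo_onD[OF V.sa_endo[OF R(1)]] by (simp add: linear_bij_def linear_on_def)
  let ?r = "inv_into V R"
  note r_lin = linear_bij_inv[OF V.fd_space_axioms R_lin]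
  define \<eta> where "\<eta> = (\<lambda>x. \<theta> (?r x))"
  have \<eta>: "linear_bij sc V sc' U \<eta>" unfolding \<eta>_def by (rule linear_bij_comp[OF r_lin \<theta>])
  \<comment> \<open>the n factors R are moved to all arguments and cancelled there by the substitution\<close>
  have key: "F (tmap n \<eta> w) = G (w(0 := S (w 0)))" if w: "w \<in> tuples n V" for w
  proof -
    let ?v = "tmap n ?r w"
    have v: "?v \<in> tuples n V" using w linear_bijD(4)[OF r_lin] by (rule tmap_tuples)
    have Rv: "tmap n R ?v = w"
      unfolding tmap_tmap by (rule tmap_id[OF w]) (rule bij_betw_inv_into_right[OF Rbij])
    have v0: "?v 0 \<in> V" by (rule tuples_mem[OF v 0])
    let ?v' = "?v(0 := S (?v 0))"
    have v': "?v' \<in> tuples n V" by (rule tuples_upd[OF v 0 V.sa_closed[OF S(1) v0]])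
    have "(R ^^ n) (S (?v 0)) = \<psi> (?v 0)"
      using root[OF V.sa_closed[OF S(1) v0]] S(2,4) v0 V.sa_closed[OF \<psi>(1)] V.sa_closed[OF S(1)]
      by metis
    then have "?v(0 := \<psi> (?v 0)) = ?v'(0 := (R ^^ n) (?v' 0))" by simp
    moreover have "R (?v 0) = w 0"
      using 0 bij_betw_inv_into_right[OF Rbij tuples_mem[OF w 0]] by simp
    then have "tmap n R ?v' = w(0 := S (w 0))"
      unfolding tmap_upd[OF 0] Rv using S(3)[OF v0] by (simp only:)
    moreover have "F (tmap n \<eta> w) = F (tmap n \<theta> ?v)" unfolding tmap_tmap \<eta>_def ..
    ultimately show ?thesis
      using twist[OF v] V.sa_power_distribute[OF R(1) v' 0] by metis
  qed
  let ?e = "\<lambda>x. sc (1 / 2) (x + S x)"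
  have e: "form_projection n sc V G ?e"
    by (rule V.sa_halves_projection[OF S(1,2)]) simp_all
  note eS = V.sa_closed[OF S(1)] V.endo_onD[OF V.sa_endo[OF S(1)]]
  \<comment> \<open>the projection to the fixed space is first shown to belong to the pulled-back form H\<close>
  define H where "H v = F (tmap n \<eta> v)" for v
  have "self_adjoint n sc V H ?e"
    unfolding self_adjoint_def
  proof (intro conjI ballI allI impI)
    show "endo_on sc V ?e" by (rule V.sa_endo[OF V.proj_sa[OF e]])
    have *: "H (v(i := ?e (v i))) = G (u(i := ?e (u i)))"
      if v: "v \<in> tuples n V" and i: "i < n" and u: "u = v(0 := S (v 0))" for v i u
    proof -
      have mem: "v i \<in> V" "v 0 \<in> V" using tuples_mem[OF v] i 0 by auto
      have "v(i := ?e (v i)) \<in> tuples n V"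
        by (rule tuples_upd[OF v i V.sa_closed[OF V.proj_sa[OF e] mem(1)]])
      then have "H (v(i := ?e (v i)))
          = G (v(i := ?e (v i), 0 := S ((v(i := ?e (v i))) 0)))"
        unfolding H_def by (rule key)
      also have "v(i := ?e (v i), 0 := S ((v(i := ?e (v i))) 0)) = u(i := ?e (u i))"
        using mem eS S(2) by (cases "i = 0") (auto simp: u fun_upd_twist)
      finally show ?thesis .
    qed
    fix v i j assume v: "v \<in> tuples n V" and ij: "i < n" "j < n"
    have "v(0 := S (v 0)) \<in> tuples n V"
      by (rule tuples_upd[OF v 0 V.sa_closed[OF S(1) tuples_mem[OF v 0]]])
    from V.saD[OF V.proj_sa[OF e] this ij]
    show "H (v(i := ?e (v i))) = H (v(j := ?e (v j)))"
      unfolding *[OF v ij(1) refl] *[OF v ij(2) refl] .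
  qed
  then have eH: "form_projection n sc V H ?e"
    using V.proj_idem[OF e] by (simp add: form_projection_def)
  have iso: "form_iso 1 n sc V H sc' U F \<eta>" using \<eta> by (simp add: form_iso_def H_def)
  note e' = form_iso_projection[OF V.fd_space_axioms iso one_neq_zero eH]
  let ?P = "?e ` V" and ?N = "{x \<in> V. ?e x = 0}"
  have sub: "?P \<subseteq> V" "?N \<subseteq> V" using V.sa_closed[OF V.proj_sa[OF e]] by auto
  note PV = V.proj_image_space[OF e] and NV = V.proj_kernel_space[OF e]
  interpret PV: form_space sc ?P n G by (rule PV)
  interpret NV: form_space sc ?N n G by (rule NV)
  have PU: "form_space sc' (\<eta> ` ?P) n F" using U.proj_image_space[OF e'(1)] unfolding e'(2) .
  have NU: "form_space sc' (\<eta> ` ?N) n F" using U.proj_kernel_space[OF e'(1)] unfolding e'(3) .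
  have isoP: "form_iso 1 n sc ?P G sc' (\<eta> ` ?P) F \<eta>"
    unfolding form_iso_def
  proof (intro conjI ballI)
    show "linear_bij sc ?P sc' (\<eta> ` ?P) \<eta>" by (rule linear_bij_restrict[OF \<eta> sub(1)])
    fix u assume u: "u \<in> tuples n ?P"
    have "S (u 0) = u 0" using tuples_mem[OF u 0] eS S(2) by (auto simp: add.commute)
    then show "G u = 1 * F (tmap n \<eta> u)" using key[OF tuples_mono[OF u sub(1)]] by simp
  qed
  have isoN: "form_iso (- 1) n sc ?N G sc' (\<eta> ` ?N) F \<eta>"
    unfolding form_iso_def
  proof (intro conjI ballI)
    show "linear_bij sc ?N sc' (\<eta> ` ?N) \<eta>" by (rule linear_bij_restrict[OF \<eta> sub(2)])
    fix u assume u: "u \<in> tuples n ?N"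
    have u0: "u 0 \<in> V" "u 0 + S (u 0) = 0" using tuples_mem[OF u 0] by auto
    then have "S (u 0) = sc (- 1) (u 0)" by (simp add: eq_neg_iff_add_eq_0 add.commute)
    then have "F (tmap n \<eta> u) = - 1 * G u"
      using key[OF tuples_mono[OF u sub(2)]] V.F_scale[OF tuples_mono[OF u sub(2)] 0 u0(1), of "- 1"]
      by (metis fun_upd_triv)
    then show "G u = - 1 * F (tmap n \<eta> u)" by simp
  qed
  obtain K L where K: "form_decomp n sc G ?P K" and L: "form_decomp n sc G ?N L"
    using form_decomp_exists[OF PV] form_decomp_exists[OF NV] by blast
  have "form_decomp n sc' F (\<eta> ` ?P) (image_mset ((`) \<eta>) K)"
    by (rule form_decomp_iso[OF _ K PV PU isoP, of 1]) simp
  moreover have "form_decomp n sc' F (\<eta> ` ?N) (image_mset ((`) \<eta>) L)"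
    by (rule form_decomp_iso[OF _ L NV NU isoN, of "- 1"]) simp
  ultimately have "form_decomp n sc' F U (image_mset ((`) \<eta>) K + image_mset ((`) \<eta>) L)"
    by (intro form_decomp_union[OF U e'(1)]) (simp_all only: e'(2,3))
  moreover have "rel_mset (sign_congruent n sc G sc' F) (K + L) (image_mset ((`) \<eta>) (K + L))"
  proof -
    have "sign_congruent n sc G sc' F A (\<eta> ` A)" if A: "A \<in># K + L" for A
    proof (cases "A \<in># K")
      case True
      from form_iso_restrict[OF isoP form_decomp_subset[OF K True]]
      show ?thesis unfolding sign_congruent_def by blast
    next
      case False
      then have "A \<in># L" using A by simp
      from form_iso_restrict[OF isoN form_decomp_subset[OF L this]]
      show ?thesis unfolding sign_congruent_def by blast
    qed
    then show ?thesis unfolding multiset.rel_map by (intro multiset.rel_refl_strong)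
  qed
  ultimately show ?thesis
    using that[OF form_decomp_union[OF V e K L]] by simp
qed

lemma form_decomp_zero_form_empty:
  assumes "form_decomp n sc F U N" "zero_form n U F"
  shows "N = {#}"
  using assms(1)
proof cases
  case (add e M)
  then have "e ` U \<subseteq> U" using form_decomp_subset[OF assms(1)] by simp
  then show ?thesis using add zero_form_mono[OF assms(2)] by blast
qed simp

text \<open>
  After the exchange of one summand, the complements carry forms that are twists of each other. They
  have decompositions \<open>K\<close> and \<open>L\<close> that match up to sign, and the induction hypothesis is applied once on
  each side. Counting summands instead of dimensions is possible because the first application gives
  \<open>K\<close>, and so \<open>L\<close>, the size of \<open>M'\<close>.
\<close>

lemma form_decomp_unique:
  fixes sc :: "real \<Rightarrow> 'a::ab_group_add \<Rightarrow> 'a"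
  assumes "form_space sc U n F" "form_decomp n sc F U M" "form_decomp n sc F U N"
  shows "rel_mset (sign_congruent n sc F sc F) M N"
  using assms
proof (induction "size M" arbitrary: U M N rule: less_induct)
  case less
  interpret form_space sc U n F by fact
  from less.prems(2) show ?case
  proof cases
    case zero
    then show ?thesis using form_decomp_zero_form_empty[OF less.prems(3)] by (simp add: rel_mset_Zero)
  next
    case (add e M')
    note e = add(2)
    obtain h where h: "form_projection n sc U F h" "h ` U \<in># N"
      "form_decomp n sc F {x \<in> U. h x = 0} (N - {#h ` U#})"
      "sign_congruent n sc F sc F (e ` U) (h ` U)"
      and inj: "inj_on (\<lambda>x. e (h x)) (e ` U)" "inj_on (\<lambda>x. h (e x)) (h ` U)"
      by (rule exchange_summand[OF less.prems(1) e add(4,3) less.prems(3)])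
    let ?e = "\<lambda>x. x - e x" and ?h = "\<lambda>x. x - h x"
    have e': "form_projection n sc U F ?e" and h': "form_projection n sc U F ?h"
      by (rule proj_complement[OF e], rule proj_complement[OF h(1)])
    note inj' = complement_compress_inj[OF e h(1) inj] complement_compress_inj[OF h(1) e inj(2,1)]
    note spaces = proj_image_space[OF e'] proj_image_space[OF h']
    have twist: "F (tmap n ?h v) = F (v(0 := ?e (?h (v 0))))" if "v \<in> tuples n (?e ` U)" for v
      by (rule tmap_compress[OF e' h' that])
    obtain K L where K: "form_decomp n sc F (?e ` U) K" and L: "form_decomp n sc F (?h ` U) L"
      and KL: "rel_mset (sign_congruent n sc F sc F) K L"
      by (rule twisted_common_decomposition[OF spaces projections_linear_bij[OF e' h' inj']
            proj_compress_sa[OF e' proj_sa[OF h']] inj'(1) twist])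
    have M': "form_decomp n sc F (?e ` U) M'"
      unfolding proj_complement_image[OF e] by (rule add(5))
    have N': "form_decomp n sc F (?h ` U) (N - {#h ` U#})"
      unfolding proj_complement_image[OF h(1)] by (rule h(3))
    have small: "size M' < size M" using add(1) by simp
    have M'K: "rel_mset (sign_congruent n sc F sc F) M' K"
      by (rule less.hyps[OF small spaces(1) M' K])
    have "size L < size M" using small rel_mset_size[OF M'K] rel_mset_size[OF KL] by simp
    from less.hyps[OF this spaces(2) L N']
    have "rel_mset (sign_congruent n sc F sc F) M' (N - {#h ` U#})"
      using M'K KL rel_mset_sign_congruent_trans by blast
    from rel_mset_Plus[OF h(4) this] show ?thesis unfolding add(1) using h(2) by simp
  qed
qed

section \<open>Symmetrically equivalent forms\<close>

lemma form_space_intro: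
  assumes "fin_dim_space sc U" "multilinear_form n sc U F" "2 \<le> n"
  shows "form_space sc U n F"
proof -
  interpret vector_space sc using assms(1) by (simp add: fin_dim_space_def)
  show ?thesis
    using assms by unfold_locales (auto simp: fin_dim_space_def)
qed

lemma exists_permutation_two_values:
  fixes i j k l :: nat
  assumes "i < n" "j < n" "k < n" "l < n" "i \<noteq> j" "k \<noteq> l"
  obtains \<sigma> where "\<sigma> permutes {..<n}" "\<sigma> i = k" "\<sigma> j = l"
proof -
  define j' where "j' = Transposition.transpose i k j"
  have j': "j' < n" "j' \<noteq> k" using assms by (auto simp: j'_def Transposition.transpose_def)
  let ?\<sigma> = "Transposition.transpose j' l \<circ> Transposition.transpose i k"
  have "?\<sigma> permutes {..<n}"
    using assms j' by (intro permutes_compose permutes_swap_id) auto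
  moreover have "?\<sigma> i = k" "?\<sigma> j = l"
    using j' assms(6) by (auto simp: j'_def[symmetric])
  ultimately show ?thesis using that by blast
qed

text \<open>
  The operators \<open>\<psi> k\<close> are self-adjoint by comparing a permutation with its product with a transposition.
  The operator \<open>T\<close> is the product of all \<open>\<psi> k\<close>. It is collected in the argument with number \<open>i\<close>, and the
  outcome is the same for each \<open>i\<close>, which makes \<open>T\<close> self-adjoint although the \<open>\<psi> k\<close> need not commute.
\<close>

lemma symmetrically_equivalent_imp_twist:
  fixes scU :: "'k::field \<Rightarrow> 'a::ab_group_add \<Rightarrow> 'a" and scV :: "'k \<Rightarrow> 'b::ab_group_add \<Rightarrow> 'b"
  assumes U: "form_space scU U n F" and V: "form_space scV V n G"
    and eq: "symmetrically_equivalent n scU U F scV V G"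
  obtains \<theta> T where "linear_bij scU U scV V \<theta>" "self_adjoint n scV V G T" "inj_on T V"
    "\<And>u. u \<in> tuples n U \<Longrightarrow> F u = G ((tmap n \<theta> u)(0 := T (\<theta> (u 0))))"
proof -
  interpret U: form_space scU U n F by fact
  interpret V: form_space scV V n G by fact
  have 0: "0 < n" using V.n2 by simp
  obtain \<phi> where \<phi>: "\<And>i. i < n \<Longrightarrow> linear_bij scU U scV V (\<phi> i)"
    and F\<phi>: "\<And>\<sigma> u. \<sigma> permutes {..<n} \<Longrightarrow> u \<in> tuples n U \<Longrightarrow>
      F u = G (\<lambda>k\<in>{..<n}. \<phi> (\<sigma> k) (u k))"
    using eq unfolding symmetrically_equivalent_def by blast
  let ?i = "inv_into U (\<phi> 0)"
  note \<phi>0 = \<phi>[OF 0]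
  note i = linear_bij_inv[OF U.fd_space_axioms \<phi>0]
  define \<psi> where "\<psi> k y = \<phi> k (?i y)" for k y
  define H where "H v = F (tmap n ?i v)" for v
  have \<psi>_lin: "linear_bij scV V scV V (\<psi> k)" if "k < n" for k
    unfolding \<psi>_def by (rule linear_bij_comp[OF i \<phi>[OF that]])
  note \<psi>D = linear_bijD[OF \<psi>_lin]
  have \<psi>0: "\<psi> 0 y = y" if "y \<in> V" for y
    unfolding \<psi>_def by (rule bij_betw_inv_into_right[OF linear_bijD(3)[OF \<phi>0] that])
  have H: "H v = G (\<lambda>k\<in>{..<n}. \<psi> (\<sigma> k) (v k))"
    if \<sigma>: "\<sigma> permutes {..<n}" and v: "v \<in> tuples n V" for \<sigma> v
  proof -
    have "tmap n ?i v \<in> tuples n U" using v linear_bijD(4)[OF i] by (rule tmap_tuples)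
    from F\<phi>[OF \<sigma> this] have "H v = G (\<lambda>k\<in>{..<n}. \<phi> (\<sigma> k) (tmap n ?i v k))" by (simp only: H_def)
    also have "(\<lambda>k\<in>{..<n}. \<phi> (\<sigma> k) (tmap n ?i v k)) = (\<lambda>k\<in>{..<n}. \<psi> (\<sigma> k) (v k))"
      by (auto simp: \<psi>_def)
    finally show ?thesis .
  qed
  have \<psi>_endo: "endo_on scV V (\<psi> k)" if "k < n" for k
    using \<psi>D[OF that] by (simp add: endo_on_def)
  have \<psi>_sa: "self_adjoint n scV V G (\<psi> k)" if k: "k < n" for k
  proof (cases "k = 0")
    case True
    show ?thesis using V.sa_cong[OF V.sa_id, of "\<psi> k"] \<psi>0 by (simp add: True)
  next
    case k0: False
    have "G (v(i := \<psi> k (v i))) = G (v(j := \<psi> k (v j)))"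
      if v: "v \<in> tuples n V" and ij: "i < n" "j < n" for v i j
    proof (cases "i = j")
      case False
      obtain \<sigma> where \<sigma>: "\<sigma> permutes {..<n}" "\<sigma> i = k" "\<sigma> j = 0"
        by (rule exists_permutation_two_values[OF ij k 0 False k0])
      have \<sigma>n: "\<sigma> l < n" if "l < n" for l using permutes_in_image[OF \<sigma>(1)] that by simp
      let ?\<tau> = "\<sigma> \<circ> Transposition.transpose i j"
      have \<tau>: "?\<tau> permutes {..<n}"
        using ij by (intro permutes_compose[OF _ \<sigma>(1)] permutes_swap_id) auto
      \<comment> \<open>arguments chosen such that all operators except those at i and j cancel\<close>
      define w where "w = (\<lambda>l\<in>{..<n}. if l = i \<or> l = j then v l else inv_into V (\<psi> (\<sigma> l)) (v l))"
      note mem = tuples_mem[OF v]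
      have inv: "inv_into V (\<psi> (\<sigma> l)) (v l) \<in> V" "\<psi> (\<sigma> l) (inv_into V (\<psi> (\<sigma> l)) (v l)) = v l"
        if "l < n" for l
        using \<psi>D(3)[OF \<sigma>n[OF that]] mem[OF that]
        by (metis bij_betw_def inv_into_into, metis bij_betw_inv_into_right)
      have w: "w \<in> tuples n V" using mem inv(1) by (auto simp: w_def)
      have out: "v l = undefined" if "\<not> l < n" for l using v that by (auto simp: PiE_iff extensional_def)
      have "(\<lambda>l\<in>{..<n}. \<psi> (\<sigma> l) (w l)) = v(i := \<psi> k (v i))"
        using ij \<sigma>(2,3) \<psi>0 mem inv(2) out False by (auto simp: w_def fun_eq_iff)
      moreover have "(\<lambda>l\<in>{..<n}. \<psi> (?\<tau> l) (w l)) = v(j := \<psi> k (v j))"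
        using ij \<sigma>(2,3) \<psi>0 mem inv(2) out False
        by (auto simp: w_def fun_eq_iff Transposition.transpose_def)
      ultimately show ?thesis using H[OF \<sigma>(1) w] H[OF \<tau> w] by simp
    qed simp
    then show ?thesis using \<psi>_endo[OF k] unfolding self_adjoint_def by blast
  qed
  define T where "T = rec_nat (\<lambda>x. x) (\<lambda>m f x. \<psi> m (f x))"
  have T_simps: "T 0 = (\<lambda>x. x)" "T (Suc m) = (\<lambda>x. \<psi> m (T m x))" for m
    by (simp_all add: T_def)
  have T: "endo_on scV V (T m) \<and> inj_on (T m) V" if "m \<le> n" for m
    using that
  proof (induction m)
    case 0
    then show ?case by (simp add: T_simps endo_on_def)
  next
    case (Suc m)
    then have m: "m < n" "endo_on scV V (T m)" "inj_on (T m) V" by auto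
    have "inj_on (\<psi> m) V" using \<psi>D(3)[OF m(1)] by (simp add: bij_betw_def)
    then have "inj_on (T (Suc m)) V"
      using m(3) V.endo_onD(3)[OF m(2)] unfolding T_simps inj_on_def by blast
    moreover have "endo_on scV V (T (Suc m))"
      using V.endo_onD[OF m(2)] V.endo_onD[OF \<psi>_endo[OF m(1)]] by (simp add: T_simps endo_on_def)
    ultimately show ?case by blast
  qed
  have collect: "H v = G (v(i := T n (v i)))" if v: "v \<in> tuples n V" and i: "i < n" for v i
  proof -
    define \<sigma> where "\<sigma> = Transposition.transpose 0 i"
    have \<sigma>: "\<sigma> permutes {..<n}" unfolding \<sigma>_def using 0 i by (intro permutes_swap_id) auto
    have \<sigma>i: "\<sigma> i = 0" "\<sigma> (\<sigma> l) = l" "\<sigma> l = 0 \<longleftrightarrow> l = i" for l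
      by (auto simp: \<sigma>_def Transposition.transpose_def)
    have \<sigma>n: "\<sigma> l < n \<longleftrightarrow> l < n" for l using permutes_in_image[OF \<sigma>, of l] by simp
    note mem = tuples_mem[OF v]
    \<comment> \<open>the operators with index below m have been moved to the argument i\<close>
    define w where "w m = (\<lambda>l\<in>{..<n}. if l = i then T m (v i)
      else if \<sigma> l < m then v l else \<psi> (\<sigma> l) (v l))" for m
    have "H v = G (w (Suc m))" if "m < n" for m
      using that
    proof (induction m)
      case 0
      have "(\<lambda>k\<in>{..<n}. \<psi> (\<sigma> k) (v k)) = w (Suc 0)"
        by (auto simp: w_def T_simps \<sigma>i fun_eq_iff)
      then show ?case using H[OF \<sigma> v] by simp
    next
      case (Suc m)
      let ?m = "Suc m"
      define j where "j = \<sigma> ?m"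
      have "\<sigma> j = ?m" by (simp add: j_def \<sigma>i(2))
      then have j: "j < n" "\<sigma> j = ?m" "j \<noteq> i"
        using Suc.prems \<sigma>n[of ?m] \<sigma>i(3)[of j] by (auto simp: j_def)
      \<comment> \<open>the operator with index ?m has been taken off the argument j\<close>
      define x where "x = (w ?m)(j := v j)"
      have "w ?m l \<in> V" if "l < n" for l
        using mem[OF that] mem[OF i] V.endo_onD(3)[OF conjunct1[OF T], of ?m] Suc.prems
          \<psi>D(4)[of "\<sigma> l"] \<sigma>n that by (auto simp: w_def)
      then have "w ?m \<in> tuples n V" by (auto simp: w_def[of ?m] restrict_def extensional_def PiE_iff)
      then have x: "x \<in> tuples n V" unfolding x_def by (rule tuples_upd[OF _ j(1) mem[OF j(1)]])
      have "x(j := \<psi> ?m (x j)) = w ?m"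
        using j by (auto simp: x_def w_def fun_eq_iff)
      moreover have "x(i := \<psi> ?m (x i)) = w (Suc ?m)"
      proof
        fix l
        have "\<sigma> l = ?m \<longleftrightarrow> l = j" using \<sigma>i(2) j(2) by metis
        then show "(x(i := \<psi> ?m (x i))) l = w (Suc ?m) l"
          using j i by (auto simp: x_def w_def T_simps less_Suc_eq)
      qed
      ultimately have "G (w ?m) = G (w (Suc ?m))"
        using V.saD[OF \<psi>_sa[OF Suc.prems] x j(1) i] by simp
      then show ?case using Suc by simp
    qed
    from this[of "n - 1"] have "H v = G (w n)" using 0 by simp
    also have "w n = v(i := T n (v i))"
      using v i \<sigma>n by (auto simp: w_def fun_eq_iff PiE_iff extensional_def)
    finally show ?thesis .
  qed
  have "self_adjoint n scV V G (T n)"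
    unfolding self_adjoint_def
  proof (intro conjI ballI allI impI)
    show "endo_on scV V (T n)" using T by blast
    fix v i j assume "v \<in> tuples n V" "i < n" "j < n"
    then show "G (v(i := T n (v i))) = G (v(j := T n (v j)))" using collect by metis
  qed
  moreover have "F u = G ((tmap n (\<phi> 0) u)(0 := T n (\<phi> 0 (u 0))))" if u: "u \<in> tuples n U" for u
  proof -
    have v: "tmap n (\<phi> 0) u \<in> tuples n V" using u linear_bijD(4)[OF \<phi>0] by (rule tmap_tuples)
    have "tmap n ?i (tmap n (\<phi> 0) u) = u"
      unfolding tmap_tmap by (rule tmap_id[OF u]) (rule bij_betw_inv_into_left[OF linear_bijD(3)[OF \<phi>0]])
    then show ?thesis using collect[OF v 0] 0 by (simp add: H_def)
  qed
  ultimately show ?thesis using that[OF \<phi>0] T by blast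
qed

text \<open>
  The congruence is \<open>\<theta>\<close> followed by an \<open>n\<close>-th root of the twist.
\<close>

lemma complex_symmetrically_equivalent_imp_congruent:
  fixes scU :: "complex \<Rightarrow> 'a::ab_group_add \<Rightarrow> 'a" and scV :: "complex \<Rightarrow> 'b::ab_group_add \<Rightarrow> 'b"
  assumes U: "form_space scU U n F" and V: "form_space scV V n G"
    and eq: "symmetrically_equivalent n scU U F scV V G"
  shows "congruent_forms n scU U F scV V G"
proof -
  interpret V: form_space scV V n G by fact
  have 0: "0 < n" using V.n2 by simp
  obtain \<theta> T where \<theta>: "linear_bij scU U scV V \<theta>" and T: "self_adjoint n scV V G T" "inj_on T V"
    and tw: "\<And>u. u \<in> tuples n U \<Longrightarrow> F u = G ((tmap n \<theta> u)(0 := T (\<theta> (u 0))))"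
    by (rule symmetrically_equivalent_imp_twist[OF U V eq]) blast
  obtain R where R: "self_adjoint n scV V G R" and root: "\<And>x. x \<in> V \<Longrightarrow> (R ^^ n) x = T x"
    using self_adjoint_complex_root[OF V T 0] by blast
  have "inj_on R V"
  proof (rule V.endo_root_inj[OF V.sa_endo[OF R] 0])
    fix x assume x: "x \<in> V" "(R ^^ n) x = 0"
    then have "T x = T 0" using root V.sa_zero[OF T(1)] by simp
    then show "x = 0" using inj_onD[OF T(2)] x(1) by simp
  qed
  then have R_lin: "linear_bij scV V scV V R"
    using V.endo_inj_imp_bij[OF V.sa_endo[OF R]] V.endo_onD[OF V.sa_endo[OF R]]
    by (simp add: linear_bij_def linear_on_def)
  have "F u = G (tmap n (\<lambda>x. R (\<theta> x)) u)" if u: "u \<in> tuples n U" for u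
  proof -
    let ?v = "tmap n \<theta> u"
    have v: "?v \<in> tuples n V" using u linear_bijD(4)[OF \<theta>] by (rule tmap_tuples)
    have "F u = G (?v(0 := (R ^^ n) (?v 0)))"
      using tw[OF u] root[OF tuples_mem[OF v 0]] 0 by simp
    then show ?thesis unfolding V.sa_power_distribute[OF R v 0] tmap_tmap .
  qed
  then show ?thesis
    unfolding congruent_forms_def using linear_bij_comp[OF \<theta> R_lin] by blast
qed

lemma indecomposable_decomposition_summand_space:
  assumes "form_space sc U n F" and "indecomposable_decomposition n sc U F s W" and "i < s"
  shows "form_space sc (W i) n F"
proof -
  interpret form_space sc U n F by fact
  obtain E where "\<And>p. p < Suc s \<Longrightarrow> form_projection n sc U F (E p)"
    "\<And>p. p < Suc s \<Longrightarrow> E p ` U = W p"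
    using direct_sum_projections assms(2) unfolding indecomposable_decomposition_def by metis
  then show ?thesis using proj_image_space assms(3) by (metis less_SucI)
qed

text \<open>
  Turns a matching of multisets back into a reindexing of families.
\<close>

lemma rel_mset_imp_permutation:
  fixes A :: "nat \<Rightarrow> 'a" and B :: "nat \<Rightarrow> 'b"
  assumes "rel_mset R (image_mset A (mset_set {..<r})) (image_mset B (mset_set {..<s}))"
  shows "s = r \<and> (\<exists>\<pi>. \<pi> permutes {..<s} \<and> (\<forall>i<s. R (A (\<pi> i)) (B i)))"
proof -
  have ms: "image_mset f (mset_set {..<k}) = mset (map f [0..<k])" for f :: "nat \<Rightarrow> 'c" and k
    by (simp add: atLeast0LessThan)
  have rs: "s = r" using rel_mset_size[OF assms] by simp
  obtain xs ys where "mset xs = mset (map A [0..<r])" "mset ys = mset (map B [0..<s])"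
    "list_all2 R xs ys"
    using assms unfolding rel_mset_def ms by blast
  then obtain zs where zs: "list_all2 R (map A [0..<r]) zs" "mset zs = mset (map B [0..<s])"
    using list_all2_reorder_left_invariance by metis
  then obtain \<pi> where \<pi>: "\<pi> permutes {..<length zs}" "permute_list \<pi> zs = map B [0..<s]"
    by (metis mset_eq_permutation)
  have len: "length zs = s" using zs(1) rs by (simp add: list_all2_conv_all_nth)
  have "R (A (\<pi> i)) (B i)" if i: "i < s" for i
  proof -
    have "\<pi> i < s" using permutes_in_image[OF \<pi>(1), of i] i len by simp
    moreover have "zs ! \<pi> i = B i"
      using permute_list_nth[OF \<pi>(1), of i] i len unfolding \<pi>(2) by simp
    ultimately show ?thesis using zs(1) rs by (auto simp: list_all2_conv_all_nth)
  qed
  then show ?thesis using rs \<pi>(1) len by blast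
qed

lemma sign_congruent_imp_congruent:
  assumes "fd_space sc A" and "sign_congruent n sc F sc' G A B"
  shows "congruent_forms n sc' B G sc A F \<or> congruent_forms n sc' B G sc A (\<lambda>x. - F x)"
proof -
  obtain c \<theta> where c: "c \<in> {1, - 1 :: real}" and iso: "form_iso c n sc A F sc' B G \<theta>"
    using assms(2) unfolding sign_congruent_def by blast
  from form_iso_inv[OF assms(1) iso, of c] c
  have "form_iso c n sc' B G sc A F (inv_into A \<theta>)" by auto
  then show ?thesis using c unfolding form_iso_def congruent_forms_def by auto
qed

text \<open>
  The given decompositions are compared with the decompositions \<open>M\<close> of \<open>G\<close> and \<open>N\<close> of \<open>F\<close>, which match by
  construction.
\<close>

lemma real_symmetrically_equivalent_summands:
  fixes scU :: "real \<Rightarrow> 'a::ab_group_add \<Rightarrow> 'a" and scV :: "real \<Rightarrow> 'b::ab_group_add \<Rightarrow> 'b"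
  assumes U: "form_space scU U n F" and V: "form_space scV V n G"
    and eq: "symmetrically_equivalent n scU U F scV V G"
    and P: "indecomposable_decomposition n scU U F s P"
    and Q: "indecomposable_decomposition n scV V G r Q"
  shows "s = r \<and> (\<exists>\<pi>. \<pi> permutes {..<s} \<and>
    (\<forall>i<s. congruent_forms n scU (P i) F scV (Q (\<pi> i)) G \<or>
           congruent_forms n scU (P i) F scV (Q (\<pi> i)) (\<lambda>x. - G x)))"
proof -
  interpret U: form_space scU U n F by fact
  interpret V: form_space scV V n G by fact
  have 0: "0 < n" using V.n2 by simp
  obtain \<theta> T where \<theta>: "linear_bij scU U scV V \<theta>" and T: "self_adjoint n scV V G T" "inj_on T V"
    and tw: "\<And>u. u \<in> tuples n U \<Longrightarrow> F u = G ((tmap n \<theta> u)(0 := T (\<theta> (u 0))))"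
    by (rule symmetrically_equivalent_imp_twist[OF U V eq]) blast
  let ?i = "inv_into U \<theta>"
  note i = linear_bij_inv[OF U.fd_space_axioms \<theta>]
  have "F (tmap n ?i v) = G (v(0 := T (v 0)))" if v: "v \<in> tuples n V" for v
  proof -
    have u: "tmap n ?i v \<in> tuples n U" using v linear_bijD(4)[OF i] by (rule tmap_tuples)
    have "tmap n \<theta> (tmap n ?i v) = v"
      unfolding tmap_tmap by (rule tmap_id[OF v]) (rule bij_betw_inv_into_right[OF linear_bijD(3)[OF \<theta>]])
    moreover have "\<theta> (tmap n ?i v 0) = v 0"
      using 0 bij_betw_inv_into_right[OF linear_bijD(3)[OF \<theta>] tuples_mem[OF v 0]] by simp
    ultimately show ?thesis using tw[OF u] by (simp only:)
  qed
  then obtain M N where M: "form_decomp n scV G V M" and N: "form_decomp n scU F U N"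
    and MN: "rel_mset (sign_congruent n scV G scU F) M N"
    by (rule twisted_common_decomposition[OF V U i T])
  note QM = form_decomp_unique[OF V indecomposable_decomposition_imp_form_decomp[OF V Q] M]
  note NP = form_decomp_unique[OF U N indecomposable_decomposition_imp_form_decomp[OF U P]]
  have "rel_mset (sign_congruent n scV G scU F)
      (image_mset Q (mset_set {..<r})) (image_mset P (mset_set {..<s}))"
    by (rule rel_mset_sign_congruent_trans[OF QM rel_mset_sign_congruent_trans[OF MN NP]])
  from rel_mset_imp_permutation[OF this] obtain \<pi> where
    \<pi>: "s = r" "\<pi> permutes {..<s}" "\<And>i. i < s \<Longrightarrow> sign_congruent n scV G scU F (Q (\<pi> i)) (P i)"
    by blast
  have "congruent_forms n scU (P i) F scV (Q (\<pi> i)) G \<or>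
      congruent_forms n scU (P i) F scV (Q (\<pi> i)) (\<lambda>x. - G x)" if "i < s" for i
  proof -
    have "\<pi> i < r" using permutes_in_image[OF \<pi>(2), of i] that \<pi>(1) by simp
    from indecomposable_decomposition_summand_space[OF V Q this]
    have "fd_space scV (Q (\<pi> i))" by (rule form_space.axioms(1))
    then show ?thesis by (rule sign_congruent_imp_congruent) (rule \<pi>(3)[OF that])
  qed
  then show ?thesis using \<pi>(1,2) by blast
qed

theorem theorem2:
  fixes n :: nat
    and scU :: "complex \<Rightarrow> 'a::ab_group_add \<Rightarrow> 'a" and U :: "'a set" and F :: "(nat \<Rightarrow> 'a) \<Rightarrow> complex"
    and scV :: "complex \<Rightarrow> 'b::ab_group_add \<Rightarrow> 'b" and V :: "'b set" and G :: "(nat \<Rightarrow> 'b) \<Rightarrow> complex"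
    and scU' :: "real \<Rightarrow> 'c::ab_group_add \<Rightarrow> 'c" and U' :: "'c set" and F' :: "(nat \<Rightarrow> 'c) \<Rightarrow> real"
    and scV' :: "real \<Rightarrow> 'd::ab_group_add \<Rightarrow> 'd" and V' :: "'d set" and G' :: "(nat \<Rightarrow> 'd) \<Rightarrow> real"
    and s r :: nat and P :: "nat \<Rightarrow> 'c set" and Q :: "nat \<Rightarrow> 'd set"
  assumes "n \<ge> 2"
  shows
    "(fin_dim_space scU U \<and> fin_dim_space scV V \<and>
      multilinear_form n scU U F \<and> multilinear_form n scV V G \<and>
      symmetrically_equivalent n scU U F scV V G
      \<longrightarrow> congruent_forms n scU U F scV V G)
     \<and>
     (fin_dim_space scU' U' \<and> fin_dim_space scV' V' \<and>
      multilinear_form n scU' U' F' \<and> multilinear_form n scV' V' G' \<and>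
      symmetrically_equivalent n scU' U' F' scV' V' G' \<and>
      indecomposable_decomposition n scU' U' F' s P \<and>
      indecomposable_decomposition n scV' V' G' r Q
      \<longrightarrow> s = r \<and>
          (\<exists>\<pi>. \<pi> permutes {..<s} \<and>
             (\<forall>i<s. congruent_forms n scU' (P i) F' scV' (Q (\<pi> i)) G' \<or>
                    congruent_forms n scU' (P i) F' scV' (Q (\<pi> i)) (\<lambda>x. - G' x))))"
proof (rule conjI; intro impI; elim conjE)
  assume "fin_dim_space scU U" "fin_dim_space scV V" "multilinear_form n scU U F"
    "multilinear_form n scV V G" "symmetrically_equivalent n scU U F scV V G"
  then show "congruent_forms n scU U F scV V G"
    by (intro complex_symmetrically_equivalent_imp_congruent form_space_intro assms)
next
  assume "fin_dim_space scU' U'" "fin_dim_space scV' V'" "multilinear_form n scU' U' F'"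
    "multilinear_form n scV' V' G'" "symmetrically_equivalent n scU' U' F' scV' V' G'"
    "indecomposable_decomposition n scU' U' F' s P" "indecomposable_decomposition n scV' V' G' r Q"
  then show "s = r \<and> (\<exists>\<pi>. \<pi> permutes {..<s} \<and>
      (\<forall>i<s. congruent_forms n scU' (P i) F' scV' (Q (\<pi> i)) G' \<or>
             congruent_forms n scU' (P i) F' scV' (Q (\<pi> i)) (\<lambda>x. - G' x)))"
    using assms by (intro real_symmetrically_equivalent_summands[of scU' U' n F' scV' V' G']
        form_space_intro) auto
qed

end
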